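(* Let $R$ be a ring, let $\mathcal T$ be a triangulated subcategory of $\mathbf K(\mathrm{Mod}\text{-}R)$ and let $\mathcal D$ be a thick subcategory of $\mathcal T$. Suppose that $\mathcal T$ has enough $\mathrm{Mor}_{\mathcal D}$-injective objects. Then the Verdier quotient $\mathcal T/\mathcal D$ has small Hom-sets.
   Context: $R$ is an associative, not necessarily commutative, ring with unit; modules are right $R$-modules. $\mathbf K(\mathrm{Mod}\text{-}R)$ is the homotopy category: objects are (unbounded) cochain complexes of modules, morphisms are homotopy classes of cochain maps. Shifts are given by $X[n]^k=X^{k-n}$, $d_{X[n]}^k=(-1)^n d_X^{k-n}$. The cone of a cochain map $f:X\to Y$ has $\mathrm{cone}(f)^n=X^{n+1}\oplus Y^n$ and $d^n(x,y)=(-d_X^{n+1}(x),\,d_Y^n(y)-f^{n+1}(x))$. $\mathbf K(\mathrm{Mod}\text{-}R)$ is triangulated with exact triangles those isomorphic to $X\xrightarrow{f}Y\to \mathrm{cone}(f)\to X[-1]$ (canonical injection and projection). A full subcategory $\mathcal D$ is closed under cones if for every exact triangle $X\to Y\to Z\to X[-1]$ with $X,Y\in\mathcal D$ also $Z\in\mathcal D$; it is triangulated if it is closed under isomorphisms and cones and $\mathcal D[-1]=\mathcal D$; it is thick if it is triangulated and closed under direct summands. $\mathrm{Mor}_{\mathcal D}$ is the class of morphisms $f:X\to Y$ in $\mathcal T$ for which there is an exact triangle $X\xrightarrow{f}Y\to Z\to X[-1]$ with $Z\in\mathcal D$. An object $E$ of $\mathcal T$ is $\mathrm{Mor}_{\mathcal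 D}$-injective if $\mathrm{Hom}_{\mathcal T}(i,E)$ is surjective for every $i\in\mathrm{Mor}_{\mathcal D}$; $\mathcal T$ has enough $\mathrm{Mor}_{\mathcal D}$-injective objects if for every object $A$ of $\mathcal T$ there is a morphism $i:A\to E$ in $\mathrm{Mor}_{\mathcal D}$ with $E$ $\mathrm{Mor}_{\mathcal D}$-injective. The Verdier quotient $\mathcal T/\mathcal D$ has the same objects as $\mathcal T$; a morphism $X\to Y$ is an equivalence class of triples $(Z,f,g)$ with $f:Z\to X$ in $\mathrm{Mor}_{\mathcal D}$ and $g:Z\to Y$ a morphism in $\mathcal T$, where $(Z,f,g)\sim(Z',f',g')$ iff there are a triple $(Z'',f'',g'')$ of the same kind and morphisms $u:Z''\to Z$, $v:Z''\to Z'$ with $fu=f''=f'v$ and $gu=g''=g'v$. It has small Hom-sets if, for all objects $X,Y$, the class of morphisms from $X$ to $Y$ is a (small) set rather than a proper class. *)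

theory Defs
  imports "HOL-Algebra.Module" "HOL-Library.Equipollence"
begin

section \<open>Sets and proper classes\<close>

text \<open>
  The category of all modules over a ring is a proper class, which HOL does not have. A type
  \<open>'v\<close> of the following class plays the role of the class of all sets: its cardinality is
  strongly inaccessible (uncountable, a strong limit, and regular). A collection \<open>A\<close> of elements
  of any type counts as a (small) set iff \<open>A \<prec> (UNIV :: 'v set)\<close>, and as a proper class
  otherwise (limitation of size). Up to isomorphism every small module has a carrier that is a
  small subset of \<open>'v\<close>. Sets of complexes (of any size) are the classes of complexes.
\<close>

class universe =
  assumes small_nat: "(UNIV :: nat set) \<prec> (UNIV :: 'a set)"
    and small_Pow: "(A :: 'a set) \<prec> (UNIV :: 'a set) \<Longrightarrow> Pow A \<prec> (UNIV :: 'a set)"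
    and small_UN: "\<lbrakk>(I :: 'a set) \<prec> (UNIV :: 'a set); \<And>i. i \<in> I \<Longrightarrow> F i \<prec> (UNIV :: 'a set)\<rbrakk>
                     \<Longrightarrow> (\<Union>i\<in>I. F i) \<prec> (UNIV :: 'a set)"

text \<open>
  An encoding of pairs inside \<open>'v\<close>, needed so that direct sums of modules with carriers in
  \<open>'v\<close> again have carriers in \<open>'v\<close>. It exists since \<open>'v\<close> is infinite.
\<close>

definition vpair :: "'v \<times> 'v \<Rightarrow> 'v::universe"
  where "vpair = (SOME p. inj p)"

definition vfst :: "'v \<Rightarrow> 'v::universe"
  where "vfst p = fst (inv_into UNIV vpair p)"

definition vsnd :: "'v \<Rightarrow> 'v::universe"
  where "vsnd p = snd (inv_into UNIV vpair p)"


section \<open>Right modules\<close>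

text \<open>
  The library's locale \<open>module\<close> is restricted to commutative rings. In the record of a right
  module, \<open>a \<odot>\<^bsub>M\<^esub> x\<close> stands for the right action \<open>x a\<close>, whence the order of factors in
  \<open>ract_assoc\<close>.
\<close>

locale right_module = R?: ring R + M?: abelian_group M for R (structure) and M (structure) +
  assumes ract_closed:
      "\<lbrakk>a \<in> carrier R; x \<in> carrier M\<rbrakk> \<Longrightarrow> a \<odot>\<^bsub>M\<^esub> x \<in> carrier M"
    and ract_ring_distr:
      "\<lbrakk>a \<in> carrier R; b \<in> carrier R; x \<in> carrier M\<rbrakk>
        \<Longrightarrow> (a \<oplus> b) \<odot>\<^bsub>M\<^esub> x = a \<odot>\<^bsub>M\<^esub> x \<oplus>\<^bsub>M\<^esub> b \<odot>\<^bsub>M\<^esub> x"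
    and ract_module_distr:
      "\<lbrakk>a \<in> carrier R; x \<in> carrier M; y \<in> carrier M\<rbrakk>
        \<Longrightarrow> a \<odot>\<^bsub>M\<^esub> (x \<oplus>\<^bsub>M\<^esub> y) = a \<odot>\<^bsub>M\<^esub> x \<oplus>\<^bsub>M\<^esub> a \<odot>\<^bsub>M\<^esub> y"
    and ract_assoc:
      "\<lbrakk>a \<in> carrier R; b \<in> carrier R; x \<in> carrier M\<rbrakk>
        \<Longrightarrow> (a \<otimes> b) \<odot>\<^bsub>M\<^esub> x = b \<odot>\<^bsub>M\<^esub> (a \<odot>\<^bsub>M\<^esub> x)"
    and ract_one: "x \<in> carrier M \<Longrightarrow> \<one> \<odot>\<^bsub>M\<^esub> x = x"

text \<open>
  The last four conditions remove arbitrary data from the record (the unused ring fields, and the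
  values of the operations outside the carriers), so that equality of records is equality of
  modules.
\<close>

definition right_modules :: "('r, 'm) ring_scheme \<Rightarrow> ('r, 'v) module set"
  where "right_modules R =
    {M. right_module R M \<and> carrier M \<prec> (UNIV :: 'v set) \<and>
        (\<lambda>(x, y). x \<oplus>\<^bsub>M\<^esub> y) \<in> extensional (carrier M \<times> carrier M) \<and>
        (\<lambda>(a, x). a \<odot>\<^bsub>M\<^esub> x) \<in> extensional (carrier R \<times> carrier M) \<and>
        mult M = undefined \<and> one M = undefined}"

definition module_homs :: "('r, 'm) ring_scheme \<Rightarrow> ('r, 'v) module \<Rightarrow> ('r, 'v) module \<Rightarrow> ('v \<Rightarrow> 'v) set"
  where "module_homs R M N =
    {f \<in> carrier M \<rightarrow>\<^sub>E carrier N.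
       (\<forall>x\<in>carrier M. \<forall>y\<in>carrier M. f (x \<oplus>\<^bsub>M\<^esub> y) = f x \<oplus>\<^bsub>N\<^esub> f y) \<and>
       (\<forall>a\<in>carrier R. \<forall>x\<in>carrier M. f (a \<odot>\<^bsub>M\<^esub> x) = a \<odot>\<^bsub>N\<^esub> f x)}"

definition direct_sum ::
    "('r, 'm) ring_scheme \<Rightarrow> ('r, 'v::universe) module \<Rightarrow> ('r, 'v) module \<Rightarrow> ('r, 'v) module"
  where "direct_sum R M N =
    (let C = vpair ` (carrier M \<times> carrier N) in
     \<lparr>carrier = C, mult = undefined, one = undefined,
      zero = vpair (\<zero>\<^bsub>M\<^esub>, \<zero>\<^bsub>N\<^esub>),
      add = curry (\<lambda>(p, q)\<in>C \<times> C. vpair (vfst p \<oplus>\<^bsub>M\<^esub> vfst q, vsnd p \<oplus>\<^bsub>N\<^esub> vsnd q)),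
      smult = curry (\<lambda>(a, p)\<in>carrier R \<times> C. vpair (a \<odot>\<^bsub>M\<^esub> vfst p, a \<odot>\<^bsub>N\<^esub> vsnd p))\<rparr>)"


section \<open>The homotopy category\<close>

record ('r, 'v) cpx =
  obj :: "int \<Rightarrow> ('r, 'v) module"
  diff :: "int \<Rightarrow> 'v \<Rightarrow> 'v"

definition complexes :: "('r, 'm) ring_scheme \<Rightarrow> ('r, 'v) cpx set"
  where "complexes R =
    {X. (\<forall>n. obj X n \<in> right_modules R) \<and>
        (\<forall>n. diff X n \<in> module_homs R (obj X n) (obj X (n + 1))) \<and>
        (\<forall>n. \<forall>x\<in>carrier (obj X n). diff X (n + 1) (diff X n x) = \<zero>\<^bsub>obj X (n + 2)\<^esub>)}"

definition cochain_maps ::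
    "('r, 'm) ring_scheme \<Rightarrow> ('r, 'v) cpx \<Rightarrow> ('r, 'v) cpx \<Rightarrow> (int \<Rightarrow> 'v \<Rightarrow> 'v) set"
  where "cochain_maps R X Y =
    {f. (\<forall>n. f n \<in> module_homs R (obj X n) (obj Y n)) \<and>
        (\<forall>n. \<forall>x\<in>carrier (obj X n). f (n + 1) (diff X n x) = diff Y n (f n x))}"

definition homotopy_rel ::
    "('r, 'm) ring_scheme \<Rightarrow> ('r, 'v) cpx \<Rightarrow> ('r, 'v) cpx
      \<Rightarrow> ((int \<Rightarrow> 'v \<Rightarrow> 'v) \<times> (int \<Rightarrow> 'v \<Rightarrow> 'v)) set"
  where "homotopy_rel R X Y =
    {(f, g). f \<in> cochain_maps R X Y \<and> g \<in> cochain_maps R X Y \<and>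
       (\<exists>s. (\<forall>n. s n \<in> module_homs R (obj X n) (obj Y (n - 1))) \<and>
            (\<forall>n. \<forall>x\<in>carrier (obj X n).
               f n x \<ominus>\<^bsub>obj Y n\<^esub> g n x
                 = diff Y (n - 1) (s n x) \<oplus>\<^bsub>obj Y n\<^esub> s (n + 1) (diff X n x)))}"

type_synonym 'v kmor = "(int \<Rightarrow> 'v \<Rightarrow> 'v) set"

definition homotopy_class ::
    "('r, 'm) ring_scheme \<Rightarrow> ('r, 'v) cpx \<Rightarrow> ('r, 'v) cpx \<Rightarrow> (int \<Rightarrow> 'v \<Rightarrow> 'v) \<Rightarrow> 'v kmor"
  where "homotopy_class R X Y f = homotopy_rel R X Y `` {f}"

definition KHom :: "('r, 'm) ring_scheme \<Rightarrow> ('r, 'v) cpx \<Rightarrow> ('r, 'v) cpx \<Rightarrow> 'v kmor set"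
  where "KHom R X Y = cochain_maps R X Y // homotopy_rel R X Y"

definition kid :: "('r, 'm) ring_scheme \<Rightarrow> ('r, 'v) cpx \<Rightarrow> 'v kmor"
  where "kid R X = homotopy_class R X X (\<lambda>n. \<lambda>x\<in>carrier (obj X n). x)"

text \<open>
  \<open>kcomp R X Z G F\<close> is the composite \<open>G F\<close> of \<open>F : X \<rightarrow> Y\<close> and \<open>G : Y \<rightarrow> Z\<close>; the union is over
  equal classes.
\<close>

definition kcomp ::
    "('r, 'm) ring_scheme \<Rightarrow> ('r, 'v) cpx \<Rightarrow> ('r, 'v) cpx \<Rightarrow> 'v kmor \<Rightarrow> 'v kmor \<Rightarrow> 'v kmor"
  where "kcomp R X Z G F =
    (\<Union>g\<in>G. \<Union>f\<in>F. homotopy_class R X Z (\<lambda>n. compose (carrier (obj X n)) (g n) (f n)))"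

definition kisos :: "('r, 'm) ring_scheme \<Rightarrow> ('r, 'v) cpx \<Rightarrow> ('r, 'v) cpx \<Rightarrow> 'v kmor set"
  where "kisos R X Y =
    {F \<in> KHom R X Y. \<exists>G\<in>KHom R Y X. kcomp R X X G F = kid R X \<and> kcomp R Y Y F G = kid R Y}"


section \<open>Shift, direct sum, cone and exact triangles\<close>

text \<open>The convention is \<open>X[n]\<^sup>k = X\<^sup>k\<^sup>-\<^sup>n\<close>, so that the suspension is \<open>X[-1]\<close>.\<close>

definition shift :: "int \<Rightarrow> ('r, 'v) cpx \<Rightarrow> ('r, 'v) cpx"
  where "shift n X =
    \<lparr>obj = (\<lambda>k. obj X (k - n)),
     diff = (\<lambda>k. \<lambda>x\<in>carrier (obj X (k - n)).
       if even n then diff X (k - n) x else \<ominus>\<^bsub>obj X (k - n + 1)\<^esub> diff X (k - n) x)\<rparr>"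

definition kshift :: "int \<Rightarrow> 'v kmor \<Rightarrow> 'v kmor"
  where "kshift n F = (\<lambda>f k. f (k - n)) ` F"

definition cpx_direct_sum ::
    "('r, 'm) ring_scheme \<Rightarrow> ('r, 'v::universe) cpx \<Rightarrow> ('r, 'v) cpx \<Rightarrow> ('r, 'v) cpx"
  where "cpx_direct_sum R X Y =
    \<lparr>obj = (\<lambda>n. direct_sum R (obj X n) (obj Y n)),
     diff = (\<lambda>n. \<lambda>p\<in>carrier (direct_sum R (obj X n) (obj Y n)).
       vpair (diff X n (vfst p), diff Y n (vsnd p)))\<rparr>"

definition cone ::
    "('r, 'm) ring_scheme \<Rightarrow> ('r, 'v::universe) cpx \<Rightarrow> ('r, 'v) cpx \<Rightarrow> (int \<Rightarrow> 'v \<Rightarrow> 'v)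
      \<Rightarrow> ('r, 'v) cpx"
  where "cone R X Y f =
    \<lparr>obj = (\<lambda>n. direct_sum R (obj X (n + 1)) (obj Y n)),
     diff = (\<lambda>n. \<lambda>p\<in>carrier (direct_sum R (obj X (n + 1)) (obj Y n)).
       vpair (\<ominus>\<^bsub>obj X (n + 2)\<^esub> diff X (n + 1) (vfst p),
              diff Y n (vsnd p) \<ominus>\<^bsub>obj Y (n + 1)\<^esub> f (n + 1) (vfst p)))\<rparr>"

definition cone_inj :: "('r, 'v::universe) cpx \<Rightarrow> ('r, 'v) cpx \<Rightarrow> int \<Rightarrow> 'v \<Rightarrow> 'v"
  where "cone_inj X Y n = (\<lambda>y\<in>carrier (obj Y n). vpair (\<zero>\<^bsub>obj X (n + 1)\<^esub>, y))"

definition cone_proj ::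
    "('r, 'm) ring_scheme \<Rightarrow> ('r, 'v::universe) cpx \<Rightarrow> ('r, 'v) cpx \<Rightarrow> int \<Rightarrow> 'v \<Rightarrow> 'v"
  where "cone_proj R X Y n = (\<lambda>p\<in>carrier (direct_sum R (obj X (n + 1)) (obj Y n)). vfst p)"

text \<open>\<open>X \<rightarrow> Y \<rightarrow> Z \<rightarrow> X[-1]\<close> with morphisms \<open>F\<close>, \<open>G\<close>, \<open>H\<close>.\<close>

definition exact_triangle ::
    "('r, 'm) ring_scheme \<Rightarrow> ('r, 'v::universe) cpx \<Rightarrow> ('r, 'v) cpx \<Rightarrow> ('r, 'v) cpx
      \<Rightarrow> 'v kmor \<Rightarrow> 'v kmor \<Rightarrow> 'v kmor \<Rightarrow> bool"
  where "exact_triangle R X Y Z F G H \<longleftrightarrow>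
    X \<in> complexes R \<and> Y \<in> complexes R \<and> Z \<in> complexes R \<and>
    F \<in> KHom R X Y \<and> G \<in> KHom R Y Z \<and> H \<in> KHom R Z (shift (-1) X) \<and>
    (\<exists>X'\<in>complexes R. \<exists>Y'\<in>complexes R. \<exists>f\<in>cochain_maps R X' Y'.
     \<exists>A\<in>kisos R X X'. \<exists>B\<in>kisos R Y Y'. \<exists>C\<in>kisos R Z (cone R X' Y' f).
       kcomp R X Y' B F = kcomp R X Y' (homotopy_class R X' Y' f) A \<and>
       kcomp R Y (cone R X' Y' f) C G
         = kcomp R Y (cone R X' Y' f)
             (homotopy_class R Y' (cone R X' Y' f) (cone_inj X' Y')) B \<and>
       kcomp R Z (shift (-1) X') (kshift (-1) A) H
         = kcomp R Z (shift (-1) X')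
             (homotopy_class R (cone R X' Y' f) (shift (-1) X') (cone_proj R X' Y')) C)"


section \<open>Triangulated and thick subcategories\<close>

text \<open>
  Full subcategories are given by their classes of objects. The argument \<open>T\<close> is the ambient
  triangulated category (a full subcategory of the homotopy category, possibly all of it).
\<close>

definition triangulated_subcat ::
    "('r, 'm) ring_scheme \<Rightarrow> ('r, 'v::universe) cpx set \<Rightarrow> ('r, 'v) cpx set \<Rightarrow> bool"
  where "triangulated_subcat R T D \<longleftrightarrow>
    D \<subseteq> T \<and>
    (\<forall>X\<in>D. \<forall>Y\<in>T. kisos R X Y \<noteq> {} \<longrightarrow> Y \<in> D) \<and>
    (\<forall>X\<in>D. \<forall>Y\<in>D. \<forall>Z\<in>T. \<forall>F G H. exact_triangle R X Y Z F G H \<longrightarrow> Z \<in> D) \<and>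
    shift (-1) ` D = D"

definition thick_subcat ::
    "('r, 'm) ring_scheme \<Rightarrow> ('r, 'v::universe) cpx set \<Rightarrow> ('r, 'v) cpx set \<Rightarrow> bool"
  where "thick_subcat R T D \<longleftrightarrow>
    triangulated_subcat R T D \<and>
    (\<forall>X\<in>D. \<forall>Y\<in>T. \<forall>Y'\<in>T. kisos R X (cpx_direct_sum R Y Y') \<noteq> {} \<longrightarrow> Y \<in> D)"

definition Mor ::
    "('r, 'm) ring_scheme \<Rightarrow> ('r, 'v::universe) cpx set \<Rightarrow> ('r, 'v) cpx set
      \<Rightarrow> ('r, 'v) cpx \<Rightarrow> ('r, 'v) cpx \<Rightarrow> 'v kmor set"
  where "Mor R T D X Y =
    {F \<in> KHom R X Y. X \<in> T \<and> Y \<in> T \<and> (\<exists>Z\<in>D. \<exists>G H. exact_triangle R X Y Z F G H)}"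

definition Mor_injective ::
    "('r, 'm) ring_scheme \<Rightarrow> ('r, 'v::universe) cpx set \<Rightarrow> ('r, 'v) cpx set
      \<Rightarrow> ('r, 'v) cpx \<Rightarrow> bool"
  where "Mor_injective R T D E \<longleftrightarrow>
    E \<in> T \<and>
    (\<forall>X\<in>T. \<forall>Y\<in>T. \<forall>I\<in>Mor R T D X Y. (\<lambda>G. kcomp R X E G I) ` KHom R Y E = KHom R X E)"

definition enough_Mor_injectives ::
    "('r, 'm) ring_scheme \<Rightarrow> ('r, 'v::universe) cpx set \<Rightarrow> ('r, 'v) cpx set \<Rightarrow> bool"
  where "enough_Mor_injectives R T D \<longleftrightarrow>
    (\<forall>A\<in>T. \<exists>E. Mor_injective R T D E \<and> (\<exists>I. I \<in> Mor R T D A E))"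


section \<open>The Verdier quotient\<close>

definition roofs ::
    "('r, 'm) ring_scheme \<Rightarrow> ('r, 'v::universe) cpx set \<Rightarrow> ('r, 'v) cpx set
      \<Rightarrow> ('r, 'v) cpx \<Rightarrow> ('r, 'v) cpx \<Rightarrow> (('r, 'v) cpx \<times> 'v kmor \<times> 'v kmor) set"
  where "roofs R T D X Y = {(Z, F, G). Z \<in> T \<and> F \<in> Mor R T D Z X \<and> G \<in> KHom R Z Y}"

definition roof_equiv ::
    "('r, 'm) ring_scheme \<Rightarrow> ('r, 'v::universe) cpx set \<Rightarrow> ('r, 'v) cpx set
      \<Rightarrow> ('r, 'v) cpx \<Rightarrow> ('r, 'v) cpx
      \<Rightarrow> ((('r, 'v) cpx \<times> 'v kmor \<times> 'v kmor) \<times> (('r, 'v) cpx \<times> 'v kmor \<times> 'v kmor)) set"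
  where "roof_equiv R T D X Y =
    {((Z, F, G), (Z', F', G')).
       (Z, F, G) \<in> roofs R T D X Y \<and> (Z', F', G') \<in> roofs R T D X Y \<and>
       (\<exists>Z'' F'' G''. (Z'', F'', G'') \<in> roofs R T D X Y \<and>
          (\<exists>U\<in>KHom R Z'' Z. \<exists>V\<in>KHom R Z'' Z'.
             kcomp R Z'' X F U = F'' \<and> F'' = kcomp R Z'' X F' V \<and>
             kcomp R Z'' Y G U = G'' \<and> G'' = kcomp R Z'' Y G' V))}"

definition verdier_hom ::
    "('r, 'm) ring_scheme \<Rightarrow> ('r, 'v::universe) cpx set \<Rightarrow> ('r, 'v) cpx set
      \<Rightarrow> ('r, 'v) cpx \<Rightarrow> ('r, 'v) cpx \<Rightarrow> (('r, 'v) cpx \<times> 'v kmor \<times> 'v kmor) set set"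
  where "verdier_hom R T D X Y = roofs R T D X Y // roof_equiv R T D X Y"

definition small_verdier_homs ::
    "('r, 'm) ring_scheme \<Rightarrow> ('r, 'v::universe) cpx set \<Rightarrow> ('r, 'v) cpx set \<Rightarrow> bool"
  where "small_verdier_homs R T D \<longleftrightarrow>
    (\<forall>X\<in>T. \<forall>Y\<in>T. verdier_hom R T D X Y \<prec> (UNIV :: 'v set))"

end

theory Submission
  imports Defs
begin

text \<open>
  Let \<open>I : Y \<rightarrow> E\<close> be in \<open>Mor\<close> with \<open>E\<close> injective. By injectivity, every roof \<open>(Z, F, G)\<close> from \<open>X\<close> to \<open>Y\<close>
  admits some \<open>H : X \<rightarrow> E\<close> with \<open>H F = I G\<close>. Two roofs that admit the same \<open>H\<close> are equivalent: after
  pulling back one denominator along the other, their numerators agree after composition with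
  \<open>I\<close>, so their difference factors through an object of \<open>D\<close>, and passing to the homotopy fiber of the map to that
  object makes them equal. Hence there are at most as many classes of roofs as morphisms \<open>X \<rightarrow> E\<close> in
  the homotopy category, and these form a small set.

  Neither the octahedral axiom nor the uniqueness of cones is needed: only homotopy fibers \<open>W\<close> of maps
  \<open>Z \<rightarrow> K\<close> with \<open>K\<close> in \<open>D\<close> are composed with a map \<open>f : Z \<rightarrow> X\<close> in \<open>Mor\<close>, and the cone of \<open>W \<rightarrow> Z \<rightarrow> X\<close> is
  isomorphic, by a permutation of summands, to the cone of a map from the fiber of \<open>f\<close> to \<open>K\<close>.
\<close>


section \<open>Small sets and modules\<close>

text \<open>The source \<open>Z\<close> of a roof ranges over all of \<open>T\<close>, in general a
  proper class, so roofs cannot be counted directly; recording only \<open>H\<close> forgets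
  \<open>Z\<close>. One \<open>H\<close> is chosen for each class, and this choice is injective. An
  element of \<open>verdier_hom\<close> is a set of roofs, so two of them have to be shown equal as
  sets. This is done by two inclusions: the condition \<open>H F = I G\<close> survives
  precomposition, hence holds on a common refinement, and a roof equivalent to a refinement of a
  given roof is equivalent to that roof. Exact triangles are only isomorphic to cone triangles. Each
  morphism in \<open>Mor\<close> is therefore represented by a cochain map \<open>f\<close> between
  isomorphic objects; lifts and homotopies are written in the coordinates of its cone or fiber and
  carried back along the isomorphisms. Smallness of the Hom-sets is a matter of size: a cochain map
  is coded by its graph, a subset of one small set in \<open>'v\<close>.\<close>

lemma infinite_universe: "infinite (UNIV :: 'v::universe set)"
  using small_nat lesspoll_imp_lepoll infinite_le_lepoll by blast

lemma inj_vpair: "inj (vpair :: 'v \<times> 'v \<Rightarrow> 'v::universe)"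
proof -
  have "\<exists>p :: 'v \<times> 'v \<Rightarrow> 'v. inj p"
    using card_of_Times_same_infinite[OF infinite_universe[where 'v='v]]
    by (auto simp: card_of_ordIso[symmetric] bij_betw_def)
  then show ?thesis unfolding vpair_def by (rule someI_ex)
qed

lemma vpair_eq_iff [simp]: "vpair p = vpair q \<longleftrightarrow> p = q"
  by (simp add: inj_eq[OF inj_vpair])

lemma vfst_vpair [simp]: "vfst (vpair (x, y)) = x"
  by (simp add: vfst_def inv_f_f[OF inj_vpair])

lemma vsnd_vpair [simp]: "vsnd (vpair (x, y)) = y"
  by (simp add: vsnd_def inv_f_f[OF inj_vpair])

lemma small_image:
  "A \<prec> (UNIV :: 'v::universe set) \<Longrightarrow> f ` A \<prec> (UNIV :: 'v set)"
  by (rule lesspoll_trans1[OF image_lepoll])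

lemma small_vpair_Times:
  fixes A B :: "'v::universe set"
  assumes "A \<prec> (UNIV :: 'v set)" and "B \<prec> (UNIV :: 'v set)"
  shows "vpair ` (A \<times> B) \<prec> (UNIV :: 'v set)"
proof -
  have "vpair ` (A \<times> B) = (\<Union>x\<in>A. (\<lambda>y. vpair (x, y)) ` B)" by auto
  then show ?thesis by (simp add: small_UN small_image assms)
qed

lemma ex_inj_int: "\<exists>c :: int \<Rightarrow> 'v::universe. inj c"
proof -
  obtain c :: "nat \<Rightarrow> 'v::universe" where "inj c"
    using infinite_universe infinite_countable_subset by blast
  then have "inj (c \<circ> int_encode)" by (simp add: inj_compose inj_int_encode)
  then show ?thesis by blast
qed

text \<open>\<open>small_UN\<close> takes index sets inside \<open>'v\<close> only, so the integers
  are first copied into \<open>'v\<close>; the copy is small because it is countable.\<close>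

lemma small_UN_int:
  fixes F :: "int \<Rightarrow> 'v::universe set"
  assumes "\<And>n. F n \<prec> (UNIV :: 'v set)"
  shows "(\<Union>n. F n) \<prec> (UNIV :: 'v set)"
proof -
  obtain c :: "int \<Rightarrow> 'v" where c: "inj c" using ex_inj_int by blast
  have "range c = (\<lambda>n. c (int_decode n)) ` UNIV"
    by (metis image_image surj_int_decode)
  then have "range c \<prec> (UNIV :: 'v set)"
    using lesspoll_trans1[OF image_lepoll small_nat] by metis
  then have "(\<Union>i\<in>range c. F (inv_into UNIV c i)) \<prec> (UNIV :: 'v set)"
    by (rule small_UN) (rule assms)
  then show ?thesis
    by (simp only: image_image inv_into_f_f[OF c UNIV_I])
qed

section \<open>Linear maps between right modules\<close>

text \<open>\<open>module_homs\<close> contains extensional functions only, which explicit formulas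
  usually are not. That demand is dropped here, and the module axioms at both ends are built in, so
  that the rules \<open>lin\<close> derive linearity of a formula from its shape.
  \<open>module_homs_iff\<close> and \<open>linear_map_restrict\<close> lead back.\<close>

definition linear_map :: "('r, 'm) ring_scheme \<Rightarrow> ('r, 'v) module \<Rightarrow> ('r, 'v) module \<Rightarrow> ('v \<Rightarrow> 'v) \<Rightarrow> bool"
  where "linear_map R M N f \<longleftrightarrow> right_module R M \<and> right_module R N \<and> f \<in> carrier M \<rightarrow> carrier N \<and>
       (\<forall>x\<in>carrier M. \<forall>y\<in>carrier M. f (x \<oplus>\<^bsub>M\<^esub> y) = f x \<oplus>\<^bsub>N\<^esub> f y) \<and>
       (\<forall>a\<in>carrier R. \<forall>x\<in>carrier M. f (a \<odot>\<^bsub>M\<^esub> x) = a \<odot>\<^bsub>N\<^esub> f x)"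

lemma right_modules_right_module: "M \<in> right_modules R \<Longrightarrow> right_module R M"
  by (simp add: right_modules_def)

lemma right_module_abelian_group: "right_module R M \<Longrightarrow> abelian_group M"
  by (simp add: right_module_def)

lemma module_homs_iff:
  assumes "right_module R M" "right_module R N"
  shows "f \<in> module_homs R M N \<longleftrightarrow> linear_map R M N f \<and> f \<in> extensional (carrier M)"
  using assms by (auto simp: module_homs_def linear_map_def PiE_def)

lemma linear_map_closed: "linear_map R M N f \<Longrightarrow> x \<in> carrier M \<Longrightarrow> f x \<in> carrier N"
  by (auto simp: linear_map_def)

lemma linear_map_add:
  "linear_map R M N f \<Longrightarrow> x \<in> carrier M \<Longrightarrow> y \<in> carrier M \<Longrightarrow> f (x \<oplus>\<^bsub>M\<^esub> y) = f x \<oplus>\<^bsub>N\<^esub> f y"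
  by (auto simp: linear_map_def)

lemma linear_map_zero:
  assumes "linear_map R M N f" shows "f \<zero>\<^bsub>M\<^esub> = \<zero>\<^bsub>N\<^esub>"
proof -
  interpret M: abelian_group M using assms by (simp add: linear_map_def right_module_def)
  interpret N: abelian_group N using assms by (simp add: linear_map_def right_module_def)
  have "f \<zero>\<^bsub>M\<^esub> \<in> carrier N" using linear_map_closed[OF assms] by simp
  moreover have "f \<zero>\<^bsub>M\<^esub> \<oplus>\<^bsub>N\<^esub> f \<zero>\<^bsub>M\<^esub> = f \<zero>\<^bsub>M\<^esub>"
    using linear_map_add[OF assms, of "\<zero>\<^bsub>M\<^esub>" "\<zero>\<^bsub>M\<^esub>"] by simp
  ultimately show ?thesis using N.add.r_cancel_one' by auto
qed

lemma linear_map_neg: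
  assumes f: "linear_map R M N f" and x: "x \<in> carrier M" shows "f (\<ominus>\<^bsub>M\<^esub> x) = \<ominus>\<^bsub>N\<^esub> f x"
proof -
  interpret M: abelian_group M using assms by (simp add: linear_map_def right_module_def)
  interpret N: abelian_group N using assms by (simp add: linear_map_def right_module_def)
  have "f (\<ominus>\<^bsub>M\<^esub> x) \<oplus>\<^bsub>N\<^esub> f x = \<zero>\<^bsub>N\<^esub>"
    using linear_map_add[OF f, of "\<ominus>\<^bsub>M\<^esub> x" x] x by (simp add: M.l_neg linear_map_zero[OF f])
  then show ?thesis using N.minus_equality linear_map_closed[OF f] x by simp
qed

lemma linear_map_diff:
  assumes f: "linear_map R M N f" and "x \<in> carrier M" "y \<in> carrier M"
  shows "f (x \<ominus>\<^bsub>M\<^esub> y) = f x \<ominus>\<^bsub>N\<^esub> f y"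
proof -
  interpret M: abelian_group M using assms by (simp add: linear_map_def right_module_def)
  show ?thesis using assms by (simp add: a_minus_def linear_map_add[OF f] linear_map_neg[OF f])
qed

lemma right_module_ract_neg:
  assumes M: "right_module R M" and a: "a \<in> carrier R" and x: "x \<in> carrier M"
  shows "a \<odot>\<^bsub>M\<^esub> (\<ominus>\<^bsub>M\<^esub> x) = \<ominus>\<^bsub>M\<^esub> (a \<odot>\<^bsub>M\<^esub> x)"
proof -
  interpret M: right_module R M by (rule M)
  have "a \<odot>\<^bsub>M\<^esub> (\<ominus>\<^bsub>M\<^esub> x) \<oplus>\<^bsub>M\<^esub> a \<odot>\<^bsub>M\<^esub> x = a \<odot>\<^bsub>M\<^esub> \<zero>\<^bsub>M\<^esub>"
    using M.ract_module_distr[OF a, of "\<ominus>\<^bsub>M\<^esub> x" x] x by (simp add: M.l_neg)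
  moreover have "a \<odot>\<^bsub>M\<^esub> \<zero>\<^bsub>M\<^esub> = \<zero>\<^bsub>M\<^esub>"
    using M.ract_module_distr[OF a, of "\<zero>\<^bsub>M\<^esub>" "\<zero>\<^bsub>M\<^esub>"] M.ract_closed[OF a, of "\<zero>\<^bsub>M\<^esub>"]
      M.add.r_cancel_one' by auto
  ultimately show ?thesis using M.M.minus_equality M.ract_closed a x by simp
qed

named_theorems lin

lemma linear_map_id [lin]: "right_module R M \<Longrightarrow> linear_map R M M (\<lambda>x. x)"
  by (simp add: linear_map_def)

lemma linear_map_const_zero [lin]:
  assumes "right_module R M" and N: "right_module R N" shows "linear_map R M N (\<lambda>x. \<zero>\<^bsub>N\<^esub>)"
proof -
  interpret N: right_module R N by (rule N)
  have "a \<odot>\<^bsub>N\<^esub> \<zero>\<^bsub>N\<^esub> = \<zero>\<^bsub>N\<^esub>" if "a \<in> carrier R" for a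
    using N.ract_module_distr[OF that, of "\<zero>\<^bsub>N\<^esub>" "\<zero>\<^bsub>N\<^esub>"] N.ract_closed[OF that, of "\<zero>\<^bsub>N\<^esub>"]
      N.add.r_cancel_one' by auto
  then show ?thesis using assms by (simp add: linear_map_def)
qed

lemma linear_map_comp: "linear_map R N P g \<Longrightarrow> linear_map R M N f \<Longrightarrow> linear_map R M P (\<lambda>x. g (f x))"
  by (auto simp: linear_map_def Pi_def)

lemma linear_map_plus [lin]:
  assumes f: "linear_map R M N f" and g: "linear_map R M N g"
  shows "linear_map R M N (\<lambda>x. f x \<oplus>\<^bsub>N\<^esub> g x)"
proof -
  interpret N: right_module R N using f by (simp add: linear_map_def)
  show ?thesis using assms by (auto simp: linear_map_def Pi_def N.a_ac N.ract_module_distr)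
qed

lemma linear_map_uminus [lin]:
  assumes f: "linear_map R M N f"
  shows "linear_map R M N (\<lambda>x. \<ominus>\<^bsub>N\<^esub> f x)"
proof -
  interpret N: right_module R N using f by (simp add: linear_map_def)
  show ?thesis using assms
    by (auto simp: linear_map_def Pi_def N.M.minus_add right_module_ract_neg N.a_comm)
qed

lemma linear_map_minus [lin]:
  assumes f: "linear_map R M N f" and g: "linear_map R M N g"
  shows "linear_map R M N (\<lambda>x. f x \<ominus>\<^bsub>N\<^esub> g x)"
  unfolding a_minus_def by (intro lin f g)

lemma linear_map_restrict [simp]:
  "linear_map R M N (restrict f (carrier M)) \<longleftrightarrow> linear_map R M N f"
proof (cases "right_module R M")
  case True
  then interpret M: right_module R M .
  show ?thesis using M.ract_closed by (auto simp: linear_map_def Pi_def restrict_def)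
qed (simp add: linear_map_def)

section \<open>Binary direct sums\<close>

lemma carrier_direct_sum: "carrier (direct_sum R M N) = vpair ` (carrier M \<times> carrier N)"
  and zero_direct_sum [simp]: "\<zero>\<^bsub>direct_sum R M N\<^esub> = vpair (\<zero>\<^bsub>M\<^esub>, \<zero>\<^bsub>N\<^esub>)"
  by (simp_all add: direct_sum_def Let_def)

lemma vpair_in_direct_sum [simp]:
  "vpair (x, y) \<in> carrier (direct_sum R M N) \<longleftrightarrow> x \<in> carrier M \<and> y \<in> carrier N"
  by (auto simp: carrier_direct_sum)

lemma direct_sum_cases:
  assumes "p \<in> carrier (direct_sum R M N)"
  obtains x y where "p = vpair (x, y)" "x \<in> carrier M" "y \<in> carrier N"
  using assms by (auto simp: carrier_direct_sum)

lemma ball_direct_sum: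
  "(\<forall>p\<in>carrier (direct_sum R M N). P p) \<longleftrightarrow> (\<forall>x\<in>carrier M. \<forall>y\<in>carrier N. P (vpair (x, y)))"
  by (auto simp: carrier_direct_sum)

lemma add_direct_sum [simp]:
  "\<lbrakk>x \<in> carrier M; y \<in> carrier N; x' \<in> carrier M; y' \<in> carrier N\<rbrakk> \<Longrightarrow>
    vpair (x, y) \<oplus>\<^bsub>direct_sum R M N\<^esub> vpair (x', y') = vpair (x \<oplus>\<^bsub>M\<^esub> x', y \<oplus>\<^bsub>N\<^esub> y')"
  by (simp add: direct_sum_def Let_def restrict_def image_iff)

lemma smult_direct_sum [simp]:
  "\<lbrakk>a \<in> carrier R; x \<in> carrier M; y \<in> carrier N\<rbrakk> \<Longrightarrow>
    a \<odot>\<^bsub>direct_sum R M N\<^esub> vpair (x, y) = vpair (a \<odot>\<^bsub>M\<^esub> x, a \<odot>\<^bsub>N\<^esub> y)"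
  by (simp add: direct_sum_def Let_def restrict_def image_iff)

lemma right_module_direct_sum [lin]:
  assumes M: "right_module R M" and N: "right_module R N"
  shows "right_module R (direct_sum R M N)"
proof -
  interpret M: right_module R M by (rule M)
  interpret N: right_module R N by (rule N)
  have "abelian_group (direct_sum R M N)"
  proof (rule abelian_groupI)
    fix p assume "p \<in> carrier (direct_sum R M N)"
    then obtain x y where p: "p = vpair (x, y)" "x \<in> carrier M" "y \<in> carrier N"
      by (rule direct_sum_cases)
    show "\<exists>q\<in>carrier (direct_sum R M N). q \<oplus>\<^bsub>direct_sum R M N\<^esub> p = \<zero>\<^bsub>direct_sum R M N\<^esub>"
      by (rule bexI[of _ "vpair (\<ominus>\<^bsub>M\<^esub> x, \<ominus>\<^bsub>N\<^esub> y)"]) (use p in \<open>simp_all add: M.M.l_neg N.M.l_neg\<close>)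
  qed (auto elim!: direct_sum_cases simp: M.M.a_ac N.M.a_ac)
  then interpret S: abelian_group "direct_sum R M N" .
  show ?thesis
    by unfold_locales
      (auto elim!: direct_sum_cases simp: M.ract_closed N.ract_closed M.ract_ring_distr N.ract_ring_distr
        M.ract_module_distr N.ract_module_distr M.ract_assoc N.ract_assoc M.ract_one N.ract_one)
qed

lemma neg_direct_sum:
  assumes "right_module R M" and "right_module R N" and "x \<in> carrier M" and "y \<in> carrier N"
  shows "\<ominus>\<^bsub>direct_sum R M N\<^esub> vpair (x, y) = vpair (\<ominus>\<^bsub>M\<^esub> x, \<ominus>\<^bsub>N\<^esub> y)"
proof -
  interpret M: abelian_group M using assms(1) by (rule right_module_abelian_group)
  interpret N: abelian_group N using assms(2) by (rule right_module_abelian_group)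
  interpret S: abelian_group "direct_sum R M N"
    by (rule right_module_abelian_group[OF right_module_direct_sum[OF assms(1,2)]])
  show ?thesis by (rule S.minus_equality) (use assms in \<open>simp_all add: M.l_neg N.l_neg\<close>)
qed

lemma linear_map_vfst [lin]:
  "right_module R M \<Longrightarrow> right_module R N \<Longrightarrow> linear_map R (direct_sum R M N) M vfst"
  by (auto simp: linear_map_def right_module_direct_sum ball_direct_sum elim!: direct_sum_cases)

lemma linear_map_vsnd [lin]:
  "right_module R M \<Longrightarrow> right_module R N \<Longrightarrow> linear_map R (direct_sum R M N) N vsnd"
  by (auto simp: linear_map_def right_module_direct_sum ball_direct_sum elim!: direct_sum_cases)

lemma linear_map_vpair [lin]:
  "linear_map R L M f \<Longrightarrow> linear_map R L N g \<Longrightarrow> linear_map R L (direct_sum R M N) (\<lambda>x. vpair (f x, g x))"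
  by (auto simp: linear_map_def right_module_direct_sum Pi_def)

lemma direct_sum_in_right_modules:
  assumes "M \<in> right_modules R" and "N \<in> right_modules R"
  shows "direct_sum R M N \<in> right_modules R"
  using assms right_module_direct_sum[of R M N]
  unfolding right_modules_def
  by (simp add: carrier_direct_sum small_vpair_Times) (simp add: direct_sum_def Let_def)


section \<open>The homotopy category\<close>

lemma (in abelian_group) minus_eq_iff:
  "\<lbrakk>x \<in> carrier G; y \<in> carrier G; z \<in> carrier G\<rbrakk> \<Longrightarrow> x \<ominus> y = z \<longleftrightarrow> x = y \<oplus> z"
  unfolding a_minus_def by (metis a_comm a_inv_closed add.inv_solve_right' minus_minus)

section \<open>Complexes and cochain maps\<close>

lemma complex_module [simp, lin]: "X \<in> complexes R \<Longrightarrow> right_module R (obj X n)"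
  by (simp add: complexes_def right_modules_def)

lemma complex_group [simp]: "X \<in> complexes R \<Longrightarrow> abelian_group (obj X n)"
  by (simp add: right_module_abelian_group[of R])

lemma complex_diff [lin]: "X \<in> complexes R \<Longrightarrow> linear_map R (obj X n) (obj X (n + 1)) (diff X n)"
  by (simp add: module_homs_iff[symmetric] complexes_def)
    (metis module_homs_iff right_modules_right_module)

lemma complex_diff_pred [lin]: "X \<in> complexes R \<Longrightarrow> linear_map R (obj X (n - 1)) (obj X n) (diff X (n - 1))"
  using complex_diff[of X R "n - 1"] by simp

lemma complex_diff_succ [lin]: "X \<in> complexes R \<Longrightarrow> linear_map R (obj X (n + 1)) (obj X (n + 2)) (diff X (n + 1))"
  using complex_diff[of X R "n + 1"] by (simp add: add.assoc)

lemma diff_diff: "X \<in> complexes R \<Longrightarrow> x \<in> carrier (obj X n) \<Longrightarrow> diff X (n + 1) (diff X n x) = \<zero>\<^bsub>obj X (n + 2)\<^esub>"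
  by (simp add: complexes_def)

lemma complexesI:
  assumes "\<And>n. obj X n \<in> right_modules R"
    and "\<And>n. linear_map R (obj X n) (obj X (n + 1)) (diff X n)"
    and "\<And>n. diff X n \<in> extensional (carrier (obj X n))"
    and "\<And>n x. x \<in> carrier (obj X n) \<Longrightarrow> diff X (n + 1) (diff X n x) = \<zero>\<^bsub>obj X (n + 2)\<^esub>"
  shows "X \<in> complexes R"
proof -
  have "right_module R (obj X n)" for n using assms(1) right_modules_right_module by blast
  then have "diff X n \<in> module_homs R (obj X n) (obj X (n + 1))" for n
    using module_homs_iff assms(2,3) by blast
  then show ?thesis using assms(1,4) by (simp add: complexes_def)
qed

lemma cochain_maps_iff:
  assumes "X \<in> complexes R" and "Y \<in> complexes R"
  shows "f \<in> cochain_maps R X Y \<longleftrightarrow>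
    (\<forall>n. linear_map R (obj X n) (obj Y n) (f n) \<and> f n \<in> extensional (carrier (obj X n)) \<and>
       (\<forall>x\<in>carrier (obj X n). f (n + 1) (diff X n x) = diff Y n (f n x)))"
  using assms by (auto simp: cochain_maps_def module_homs_iff)

lemma cochain_map_linear [lin]:
  "\<lbrakk>X \<in> complexes R; Y \<in> complexes R; f \<in> cochain_maps R X Y\<rbrakk>
    \<Longrightarrow> linear_map R (obj X n) (obj Y n) (f n)"
  by (simp add: cochain_maps_iff)

lemma cochain_map_diff:
  "\<lbrakk>f \<in> cochain_maps R X Y; x \<in> carrier (obj X n)\<rbrakk>
    \<Longrightarrow> f (n + 1) (diff X n x) = diff Y n (f n x)"
  by (simp add: cochain_maps_def)

lemma cochain_map_diff_pred:
  "\<lbrakk>f \<in> cochain_maps R X Y; x \<in> carrier (obj X (n - 1))\<rbrakk>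
    \<Longrightarrow> f n (diff X (n - 1) x) = diff Y (n - 1) (f (n - 1) x)"
  using cochain_map_diff[of f R X Y x "n - 1"] by simp

lemma diff_closed [simp]:
  "X \<in> complexes R \<Longrightarrow> x \<in> carrier (obj X n) \<Longrightarrow> diff X n x \<in> carrier (obj X (n + 1))"
  by (rule linear_map_closed[OF complex_diff])

lemma diff_closed_pred [simp]:
  "X \<in> complexes R \<Longrightarrow> x \<in> carrier (obj X (n - 1)) \<Longrightarrow> diff X (n - 1) x \<in> carrier (obj X n)"
  by (rule linear_map_closed[OF complex_diff_pred])

lemma cochain_map_closed:
  "\<lbrakk>f \<in> cochain_maps R X Y; x \<in> carrier (obj X n)\<rbrakk> \<Longrightarrow> f n x \<in> carrier (obj Y n)"
  by (auto simp: cochain_maps_def module_homs_def)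

section \<open>Homotopies\<close>

text \<open>Two changes from \<open>homotopy_rel\<close> make witnesses easier to give:
  \<open>s\<close> may be any family of linear maps, extensional or not, and the identity is
  additive, \<open>f = g + (d s + s d)\<close>, so that the laws of commutative groups normalize
  it.\<close>

definition homotopic ::
    "('r, 'm) ring_scheme \<Rightarrow> ('r, 'v) cpx \<Rightarrow> ('r, 'v) cpx \<Rightarrow> (int \<Rightarrow> 'v \<Rightarrow> 'v) \<Rightarrow> (int \<Rightarrow> 'v \<Rightarrow> 'v) \<Rightarrow> bool"
  where "homotopic R X Y f g \<longleftrightarrow>
    (\<exists>s. (\<forall>n. linear_map R (obj X n) (obj Y (n - 1)) (s n)) \<and>
         (\<forall>n. \<forall>x\<in>carrier (obj X n).
            f n x = g n x \<oplus>\<^bsub>obj Y n\<^esub> (diff Y (n - 1) (s n x) \<oplus>\<^bsub>obj Y n\<^esub> s (n + 1) (diff X n x))))"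

text \<open>The codomain of \<open>s (n + 1)\<close> is literally \<open>obj Y (n + 1 - 1)\<close>;
  the degree has to be rewritten before the term can be added to elements of
  \<open>obj Y n\<close>.\<close>

lemma linear_map_closed_succ:
  "\<forall>n. linear_map R (obj X n) (obj Y (n - 1)) (s n) \<Longrightarrow> X \<in> complexes R \<Longrightarrow> x \<in> carrier (obj X n) \<Longrightarrow>
    s (n + 1) (diff X n x) \<in> carrier (obj Y n)"
  by (metis add_diff_cancel_right' diff_closed linear_map_closed)

lemma homotopy_rel_iff:
  assumes X: "X \<in> complexes R" and Y: "Y \<in> complexes R"
  shows "(f, g) \<in> homotopy_rel R X Y \<longleftrightarrow>
    f \<in> cochain_maps R X Y \<and> g \<in> cochain_maps R X Y \<and> homotopic R X Y f g"
proof -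
  have eq: "f n x \<ominus>\<^bsub>obj Y n\<^esub> g n x
                 = diff Y (n - 1) (s n x) \<oplus>\<^bsub>obj Y n\<^esub> s (n + 1) (diff X n x) \<longleftrightarrow>
            f n x = g n x \<oplus>\<^bsub>obj Y n\<^esub> (diff Y (n - 1) (s n x) \<oplus>\<^bsub>obj Y n\<^esub> s (n + 1) (diff X n x))"
    if "f \<in> cochain_maps R X Y" "g \<in> cochain_maps R X Y" "\<forall>n. linear_map R (obj X n) (obj Y (n - 1)) (s n)"
      "x \<in> carrier (obj X n)" for s n x
  proof -
    interpret Y: abelian_group "obj Y n" using Y by simp
    have "s n x \<in> carrier (obj Y (n - 1))" by (rule linear_map_closed[OF spec[OF that(3)] that(4)])
    then have "diff Y (n - 1) (s n x) \<in> carrier (obj Y n)" using Y by simp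
    then show ?thesis
      using Y.minus_eq_iff[OF cochain_map_closed[OF that(1,4)] cochain_map_closed[OF that(2,4)]
          Y.a_closed[OF _ linear_map_closed_succ[OF that(3) X that(4)]]] by blast
  qed
  show ?thesis (is "_ \<longleftrightarrow> ?fg \<and> _ \<and> _")
  proof (intro iffI conjI)
    assume fg: "(f, g) \<in> homotopy_rel R X Y"
    then obtain s where s: "\<forall>n. s n \<in> module_homs R (obj X n) (obj Y (n - 1))"
      "\<forall>n. \<forall>x\<in>carrier (obj X n). f n x \<ominus>\<^bsub>obj Y n\<^esub> g n x
                 = diff Y (n - 1) (s n x) \<oplus>\<^bsub>obj Y n\<^esub> s (n + 1) (diff X n x)"
      by (auto simp: homotopy_rel_def)
    have "\<forall>n. linear_map R (obj X n) (obj Y (n - 1)) (s n)"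
      using s(1) X Y by (simp add: module_homs_iff)
    then show "homotopic R X Y f g"
      using fg s(2) eq[of s] unfolding homotopic_def homotopy_rel_def by blast
  next
    assume fg: "f \<in> cochain_maps R X Y \<and> g \<in> cochain_maps R X Y \<and> homotopic R X Y f g"
    then obtain s where s: "\<forall>n. linear_map R (obj X n) (obj Y (n - 1)) (s n)"
      "\<forall>n. \<forall>x\<in>carrier (obj X n).
            f n x = g n x \<oplus>\<^bsub>obj Y n\<^esub> (diff Y (n - 1) (s n x) \<oplus>\<^bsub>obj Y n\<^esub> s (n + 1) (diff X n x))"
      by (auto simp: homotopic_def)
    \<comment> \<open>Restricting supplies the extensionality that \<open>homotopy_rel\<close> asks
      for; the homotopy identity evaluates \<open>s\<close> on carriers only, so it is
      preserved.\<close>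
    define s' where "s' = (\<lambda>n. restrict (s n) (carrier (obj X n)))"
    have s': "\<forall>n. linear_map R (obj X n) (obj Y (n - 1)) (s' n)" using s(1) by (simp add: s'_def)
    have "\<forall>n. \<forall>x\<in>carrier (obj X n).
            f n x = g n x \<oplus>\<^bsub>obj Y n\<^esub> (diff Y (n - 1) (s' n x) \<oplus>\<^bsub>obj Y n\<^esub> s' (n + 1) (diff X n x))"
      using s X by (simp add: s'_def)
    moreover have "\<forall>n. s' n \<in> module_homs R (obj X n) (obj Y (n - 1))"
      using s' X Y by (simp add: module_homs_iff) (simp add: s'_def)
    ultimately show "(f, g) \<in> homotopy_rel R X Y"
      using s' fg eq unfolding homotopy_rel_def by blast
  qed (auto simp: homotopy_rel_def)
qed

lemma homotopic_refl:
  assumes X: "X \<in> complexes R" and Y: "Y \<in> complexes R" and f: "f \<in> cochain_maps R X Y"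
  shows "homotopic R X Y f f"
proof -
  have "f n x = f n x \<oplus>\<^bsub>obj Y n\<^esub> (diff Y (n - 1) \<zero>\<^bsub>obj Y (n - 1)\<^esub> \<oplus>\<^bsub>obj Y n\<^esub> \<zero>\<^bsub>obj Y (n + 1 - 1)\<^esub>)"
    if "x \<in> carrier (obj X n)" for n x
  proof -
    interpret Y: abelian_group "obj Y n" using Y by simp
    show ?thesis using cochain_map_closed[OF f that]
      by (simp add: linear_map_zero[OF complex_diff_pred[OF Y]])
  qed
  then show ?thesis using X Y
    unfolding homotopic_def by (intro exI[of _ "\<lambda>n x. \<zero>\<^bsub>obj Y (n - 1)\<^esub>"]) (auto intro!: lin)
qed

lemma homotopic_sym:
  assumes X: "X \<in> complexes R" and Y: "Y \<in> complexes R" and g: "g \<in> cochain_maps R X Y"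
    and fg: "homotopic R X Y f g"
  shows "homotopic R X Y g f"
proof -
  obtain s where s: "\<forall>n. linear_map R (obj X n) (obj Y (n - 1)) (s n)"
      "\<forall>n. \<forall>x\<in>carrier (obj X n).
            f n x = g n x \<oplus>\<^bsub>obj Y n\<^esub> (diff Y (n - 1) (s n x) \<oplus>\<^bsub>obj Y n\<^esub> s (n + 1) (diff X n x))"
    using fg by (auto simp: homotopic_def)
  have "g n x = f n x \<oplus>\<^bsub>obj Y n\<^esub> (diff Y (n - 1) (\<ominus>\<^bsub>obj Y (n - 1)\<^esub> s n x)
      \<oplus>\<^bsub>obj Y n\<^esub> (\<ominus>\<^bsub>obj Y (n + 1 - 1)\<^esub> s (n + 1) (diff X n x)))"
    if x: "x \<in> carrier (obj X n)" for n x
  proof -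
    interpret Y: abelian_group "obj Y n" using Y by simp
    have c: "s n x \<in> carrier (obj Y (n - 1))" "diff Y (n - 1) (s n x) \<in> carrier (obj Y n)"
      "s (n + 1) (diff X n x) \<in> carrier (obj Y n)" "g n x \<in> carrier (obj Y n)"
      using X Y x s(1) linear_map_closed_succ[OF s(1)] linear_map_closed[of R "obj X n" _ "s n"] cochain_map_closed[OF g]
      by auto
    show ?thesis using c x s(2)
      by (simp add: linear_map_neg[OF complex_diff_pred[OF Y]] Y.minus_add[symmetric] Y.a_assoc Y.r_neg)
  qed
  then show ?thesis using X Y s(1)
    unfolding homotopic_def by (intro exI[of _ "\<lambda>n x. \<ominus>\<^bsub>obj Y (n - 1)\<^esub> s n x"]) (auto intro!: lin)
qed

lemma homotopic_trans:
  assumes X: "X \<in> complexes R" and Y: "Y \<in> complexes R" and h: "h \<in> cochain_maps R X Y"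
    and fg: "homotopic R X Y f g" and gh: "homotopic R X Y g h"
  shows "homotopic R X Y f h"
proof -
  obtain s where s: "\<forall>n. linear_map R (obj X n) (obj Y (n - 1)) (s n)"
      "\<forall>n. \<forall>x\<in>carrier (obj X n).
            f n x = g n x \<oplus>\<^bsub>obj Y n\<^esub> (diff Y (n - 1) (s n x) \<oplus>\<^bsub>obj Y n\<^esub> s (n + 1) (diff X n x))"
    using fg by (auto simp: homotopic_def)
  obtain t where t: "\<forall>n. linear_map R (obj X n) (obj Y (n - 1)) (t n)"
      "\<forall>n. \<forall>x\<in>carrier (obj X n).
            g n x = h n x \<oplus>\<^bsub>obj Y n\<^esub> (diff Y (n - 1) (t n x) \<oplus>\<^bsub>obj Y n\<^esub> t (n + 1) (diff X n x))"
    using gh by (auto simp: homotopic_def)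
  have "f n x = h n x \<oplus>\<^bsub>obj Y n\<^esub> (diff Y (n - 1) (s n x \<oplus>\<^bsub>obj Y (n - 1)\<^esub> t n x)
      \<oplus>\<^bsub>obj Y n\<^esub> (s (n + 1) (diff X n x) \<oplus>\<^bsub>obj Y (n + 1 - 1)\<^esub> t (n + 1) (diff X n x)))"
    if x: "x \<in> carrier (obj X n)" for n x
  proof -
    interpret Y: abelian_group "obj Y n" using Y by simp
    have c: "s n x \<in> carrier (obj Y (n - 1))" "diff Y (n - 1) (s n x) \<in> carrier (obj Y n)"
      "s (n + 1) (diff X n x) \<in> carrier (obj Y n)"
      "t n x \<in> carrier (obj Y (n - 1))" "diff Y (n - 1) (t n x) \<in> carrier (obj Y n)"
      "t (n + 1) (diff X n x) \<in> carrier (obj Y n)" "h n x \<in> carrier (obj Y n)"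
      using X Y x s(1) t(1) linear_map_closed_succ[OF s(1)] linear_map_closed_succ[OF t(1)]
        linear_map_closed[of R "obj X n" _ "s n"] linear_map_closed[of R "obj X n" _ "t n"] cochain_map_closed[OF h]
      by auto
    show ?thesis using c x s(2) t(2)
      by (simp add: linear_map_add[OF complex_diff_pred[OF Y]] Y.a_ac)
  qed
  then show ?thesis using X Y s(1) t(1)
    unfolding homotopic_def by (intro exI[of _ "\<lambda>n x. s n x \<oplus>\<^bsub>obj Y (n - 1)\<^esub> t n x"]) (auto intro!: lin)
qed

section \<open>Composition of homotopy classes\<close>

definition comp_maps ::
    "('r, 'v) cpx \<Rightarrow> (int \<Rightarrow> 'v \<Rightarrow> 'v) \<Rightarrow> (int \<Rightarrow> 'v \<Rightarrow> 'v) \<Rightarrow> int \<Rightarrow> 'v \<Rightarrow> 'v"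
  where "comp_maps X g f = (\<lambda>n. compose (carrier (obj X n)) (g n) (f n))"

lemma comp_maps_apply [simp]: "x \<in> carrier (obj X n) \<Longrightarrow> comp_maps X g f n x = g n (f n x)"
  by (simp add: comp_maps_def compose_def)

lemma cochain_maps_comp:
  assumes "X \<in> complexes R" "Y \<in> complexes R" "Z \<in> complexes R"
    and f: "f \<in> cochain_maps R X Y" and g: "g \<in> cochain_maps R Y Z"
  shows "comp_maps X g f \<in> cochain_maps R X Z"
proof -
  have "linear_map R (obj X n) (obj Z n) (comp_maps X g f n)" for n
    unfolding comp_maps_def compose_def linear_map_restrict
    by (rule linear_map_comp[OF cochain_map_linear[OF assms(2,3) g] cochain_map_linear[OF assms(1,2) f]])
  moreover have "comp_maps X g f n \<in> extensional (carrier (obj X n))" for n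
    by (simp add: comp_maps_def)
  ultimately show ?thesis using assms
    by (simp add: cochain_maps_iff cochain_map_diff[OF f] cochain_map_diff[OF g] cochain_map_closed[OF f])
qed

text \<open>If \<open>s\<close> joins \<open>f\<close> to \<open>f'\<close>, then \<open>g s\<close>
  joins the composites, because \<open>g\<close> commutes with the differentials. Precomposition
  with \<open>f\<close> uses \<open>s f\<close> in the same way.\<close>

lemma homotopic_comp_left:
  assumes X: "X \<in> complexes R" and Y: "Y \<in> complexes R" and Z: "Z \<in> complexes R"
    and f': "f' \<in> cochain_maps R X Y" and g: "g \<in> cochain_maps R Y Z"
    and ff': "homotopic R X Y f f'"
  shows "homotopic R X Z (comp_maps X g f) (comp_maps X g f')"
proof -
  obtain s where s: "\<forall>n. linear_map R (obj X n) (obj Y (n - 1)) (s n)"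
      "\<forall>n. \<forall>x\<in>carrier (obj X n).
            f n x = f' n x \<oplus>\<^bsub>obj Y n\<^esub> (diff Y (n - 1) (s n x) \<oplus>\<^bsub>obj Y n\<^esub> s (n + 1) (diff X n x))"
    using ff' by (auto simp: homotopic_def)
  have "g n (f n x) = g n (f' n x) \<oplus>\<^bsub>obj Z n\<^esub> (diff Z (n - 1) (g (n - 1) (s n x))
      \<oplus>\<^bsub>obj Z n\<^esub> g (n + 1 - 1) (s (n + 1) (diff X n x)))"
    if x: "x \<in> carrier (obj X n)" for n x
  proof -
    interpret Y: abelian_group "obj Y n" using Y by simp
    have c: "s n x \<in> carrier (obj Y (n - 1))" "diff Y (n - 1) (s n x) \<in> carrier (obj Y n)"
      "s (n + 1) (diff X n x) \<in> carrier (obj Y n)" "f' n x \<in> carrier (obj Y n)"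
      using X Y x s(1) linear_map_closed_succ[OF s(1)] linear_map_closed[of R "obj X n" _ "s n"] cochain_map_closed[OF f']
      by auto
    show ?thesis using c x s(2)
      by (simp add: linear_map_add[OF cochain_map_linear[OF Y Z g]] cochain_map_diff_pred[OF g])
  qed
  then show ?thesis using X Y Z s(1)
    unfolding homotopic_def
    by (intro exI[of _ "\<lambda>n x. g (n - 1) (s n x)"])
      (auto intro: linear_map_comp[OF cochain_map_linear[OF Y Z g] spec[OF s(1)]])
qed

lemma homotopic_comp_right:
  assumes X: "X \<in> complexes R" and Y: "Y \<in> complexes R" and Z: "Z \<in> complexes R"
    and f: "f \<in> cochain_maps R X Y"
    and gg': "homotopic R Y Z g g'"
  shows "homotopic R X Z (comp_maps X g f) (comp_maps X g' f)"
proof -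
  obtain s where s: "\<forall>n. linear_map R (obj Y n) (obj Z (n - 1)) (s n)"
      "\<forall>n. \<forall>x\<in>carrier (obj Y n).
            g n x = g' n x \<oplus>\<^bsub>obj Z n\<^esub> (diff Z (n - 1) (s n x) \<oplus>\<^bsub>obj Z n\<^esub> s (n + 1) (diff Y n x))"
    using gg' by (auto simp: homotopic_def)
  have "g n (f n x) = g' n (f n x) \<oplus>\<^bsub>obj Z n\<^esub> (diff Z (n - 1) (s n (f n x))
      \<oplus>\<^bsub>obj Z n\<^esub> s (n + 1) (f (n + 1) (diff X n x)))"
    if x: "x \<in> carrier (obj X n)" for n x
    using x s(2) by (simp add: cochain_map_diff[OF f] cochain_map_closed[OF f])
  then show ?thesis using X Y Z s(1)
    unfolding homotopic_def
    by (intro exI[of _ "\<lambda>n x. s n (f n x)"])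
      (auto intro: linear_map_comp[OF spec[OF s(1)] cochain_map_linear[OF X Y f]])
qed

lemma equiv_homotopy_rel:
  assumes "X \<in> complexes R" "Y \<in> complexes R"
  shows "equiv (cochain_maps R X Y) (homotopy_rel R X Y)"
proof (rule equivI)
  show "homotopy_rel R X Y \<subseteq> cochain_maps R X Y \<times> cochain_maps R X Y"
    by (auto simp: homotopy_rel_def)
  show "refl_on (cochain_maps R X Y) (homotopy_rel R X Y)"
    by (rule refl_onI) (simp add: homotopy_rel_iff assms homotopic_refl)
  show "sym (homotopy_rel R X Y)"
    by (rule symI) (simp add: homotopy_rel_iff assms homotopic_sym)
  show "trans (homotopy_rel R X Y)"
    using homotopic_trans[OF assms] by (intro transI) (simp add: homotopy_rel_iff assms, blast)
qed

lemma homotopy_class_eq_iff: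
  assumes "X \<in> complexes R" "Y \<in> complexes R" "f \<in> cochain_maps R X Y" "g \<in> cochain_maps R X Y"
  shows "homotopy_class R X Y f = homotopy_class R X Y g \<longleftrightarrow> homotopic R X Y f g"
  using eq_equiv_class_iff[OF equiv_homotopy_rel[OF assms(1,2)] assms(3,4)] assms
  by (simp add: homotopy_class_def homotopy_rel_iff)

lemma homotopy_class_in_KHom: "f \<in> cochain_maps R X Y \<Longrightarrow> homotopy_class R X Y f \<in> KHom R X Y"
  by (simp add: homotopy_class_def KHom_def quotientI)

lemma KHom_cases:
  assumes "F \<in> KHom R X Y"
  obtains f where "f \<in> cochain_maps R X Y" "F = homotopy_class R X Y f"
  using assms by (auto simp: homotopy_class_def KHom_def elim: quotientE)

lemma in_homotopy_class_iff:
  assumes "X \<in> complexes R" "Y \<in> complexes R" "f \<in> cochain_maps R X Y"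
  shows "g \<in> homotopy_class R X Y f \<longleftrightarrow> g \<in> cochain_maps R X Y \<and> homotopic R X Y f g"
  using assms by (simp add: homotopy_class_def homotopy_rel_iff)

lemma in_homotopy_class_self:
  assumes "X \<in> complexes R" "Y \<in> complexes R" "f \<in> cochain_maps R X Y"
  shows "f \<in> homotopy_class R X Y f"
  using assms by (simp add: in_homotopy_class_iff homotopic_refl)

text \<open>Since \<open>kcomp\<close> is a union over representatives, any nonempty part of a class
  serves as well as the whole class. This generality is meant for \<open>kshift\<close>, which
  produces the reindexed members of a class and is only shown to lie inside a class of the shifted
  complexes.\<close>

lemma kcomp_eqI:
  assumes X: "X \<in> complexes R" and Y: "Y \<in> complexes R" and Z: "Z \<in> complexes R"
    and f: "f \<in> cochain_maps R X Y" and g: "g \<in> cochain_maps R Y Z"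
    and G: "G \<subseteq> homotopy_class R Y Z g" "G \<noteq> {}"
  shows "kcomp R X Z G (homotopy_class R X Y f) = homotopy_class R X Z (comp_maps X g f)"
proof -
  have eq: "homotopy_class R X Z (comp_maps X g' f') = homotopy_class R X Z (comp_maps X g f)"
    if "g' \<in> G" "f' \<in> homotopy_class R X Y f" for g' f'
  proof -
    have f': "f' \<in> cochain_maps R X Y" "homotopic R X Y f f'"
      using that by (simp_all add: in_homotopy_class_iff X Y f)
    have g': "g' \<in> cochain_maps R Y Z" "homotopic R Y Z g g'"
      using that G by (auto simp add: in_homotopy_class_iff Y Z g)
    note h = cochain_maps_comp[OF X Y Z]
    have "homotopic R X Z (comp_maps X g f) (comp_maps X g' f')"
      by (rule homotopic_trans[OF X Z h[OF f'(1) g'(1)]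
           homotopic_comp_left[OF X Y Z f'(1) g f'(2)] homotopic_comp_right[OF X Y Z f'(1) g'(2)]])
    then show ?thesis using homotopy_class_eq_iff[OF X Z h[OF f g] h[OF f'(1) g'(1)]] by simp
  qed
  have "kcomp R X Z G (homotopy_class R X Y f) =
    (\<Union>g'\<in>G. \<Union>f'\<in>homotopy_class R X Y f. homotopy_class R X Z (comp_maps X g' f'))"
    by (simp add: kcomp_def comp_maps_def)
  also have "\<dots> = (\<Union>g'\<in>G. \<Union>f'\<in>homotopy_class R X Y f. homotopy_class R X Z (comp_maps X g f))"
    by (simp add: eq cong: SUP_cong)
  also have "\<dots> = homotopy_class R X Z (comp_maps X g f)"
    using in_homotopy_class_self[OF X Y f] G(2) by auto
  finally show ?thesis .
qed

lemma kcomp_homotopy_class: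
  assumes X: "X \<in> complexes R" and Y: "Y \<in> complexes R" and Z: "Z \<in> complexes R"
    and f: "f \<in> cochain_maps R X Y" and g: "g \<in> cochain_maps R Y Z"
  shows "kcomp R X Z (homotopy_class R Y Z g) (homotopy_class R X Y f) = homotopy_class R X Z (comp_maps X g f)"
  using kcomp_eqI[OF assms, of "homotopy_class R Y Z g"] in_homotopy_class_self[OF Y Z g] by blast

lemma kcomp_closed:
  assumes "X \<in> complexes R" "Y \<in> complexes R" "Z \<in> complexes R" "F \<in> KHom R X Y" "G \<in> KHom R Y Z"
  shows "kcomp R X Z G F \<in> KHom R X Z"
  using assms by (auto elim!: KHom_cases simp: kcomp_homotopy_class intro!: homotopy_class_in_KHom cochain_maps_comp)

lemma comp_maps_assoc:
  "f \<in> cochain_maps R X Y \<Longrightarrow> comp_maps X h (comp_maps X g f) = comp_maps X (comp_maps Y h g) f"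
  by (auto simp: comp_maps_def compose_def fun_eq_iff cochain_map_closed)

lemma kcomp_assoc:
  assumes W: "W \<in> complexes R" and X: "X \<in> complexes R" and Y: "Y \<in> complexes R" and Z: "Z \<in> complexes R"
    and F: "F \<in> KHom R W X" and G: "G \<in> KHom R X Y" and H: "H \<in> KHom R Y Z"
  shows "kcomp R W Z H (kcomp R W Y G F) = kcomp R W Z (kcomp R X Z H G) F"
proof -
  obtain f g h where f: "f \<in> cochain_maps R W X" "F = homotopy_class R W X f"
    and g: "g \<in> cochain_maps R X Y" "G = homotopy_class R X Y g"
    and h: "h \<in> cochain_maps R Y Z" "H = homotopy_class R Y Z h"
    using F G H by (auto elim!: KHom_cases)
  show ?thesis using W X Y Z f g h
    by (simp add: kcomp_homotopy_class cochain_maps_comp comp_maps_assoc)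
qed

definition id_map :: "('r, 'v) cpx \<Rightarrow> int \<Rightarrow> 'v \<Rightarrow> 'v"
  where "id_map X = (\<lambda>n. \<lambda>x\<in>carrier (obj X n). x)"

lemma kid_eq: "kid R X = homotopy_class R X X (id_map X)"
  by (simp add: kid_def id_map_def)

lemma id_map_in_cochain_maps: "X \<in> complexes R \<Longrightarrow> id_map X \<in> cochain_maps R X X"
  by (simp add: cochain_maps_iff id_map_def lin)

lemma kid_in_KHom: "X \<in> complexes R \<Longrightarrow> kid R X \<in> KHom R X X"
  by (simp add: kid_eq id_map_in_cochain_maps homotopy_class_in_KHom)

lemma cochain_map_extensional: "f \<in> cochain_maps R X Y \<Longrightarrow> f n \<in> extensional (carrier (obj X n))"
  by (auto simp: cochain_maps_def module_homs_def PiE_def)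

text \<open>These are equalities of functions, not just on carriers, because cochain maps are
  extensional.\<close>

lemma comp_id_map: "f \<in> cochain_maps R X Y \<Longrightarrow> comp_maps X f (id_map X) = f"
  and id_map_comp: "f \<in> cochain_maps R X Y \<Longrightarrow> comp_maps X (id_map Y) f = f"
  using cochain_map_extensional[of f R X Y]
  by (auto simp: comp_maps_def compose_def fun_eq_iff id_map_def cochain_map_closed extensional_def)

lemma kcomp_kid:
  assumes X: "X \<in> complexes R" and Y: "Y \<in> complexes R" and F: "F \<in> KHom R X Y"
  shows "kcomp R X Y F (kid R X) = F" and "kcomp R X Y (kid R Y) F = F"
proof -
  obtain f where f: "f \<in> cochain_maps R X Y" "F = homotopy_class R X Y f"
    using F by (auto elim!: KHom_cases)
  show "kcomp R X Y F (kid R X) = F" "kcomp R X Y (kid R Y) F = F"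
    using X Y f by (simp_all add: kid_eq kcomp_homotopy_class id_map_in_cochain_maps comp_id_map id_map_comp)
qed

lemma kid_in_kisos: "X \<in> complexes R \<Longrightarrow> kid R X \<in> kisos R X X"
  by (auto simp: kisos_def kid_in_KHom kcomp_kid)

definition zero_map :: "('r, 'v) cpx \<Rightarrow> ('r, 'v) cpx \<Rightarrow> int \<Rightarrow> 'v \<Rightarrow> 'v"
  where "zero_map X Y = (\<lambda>n. \<lambda>x\<in>carrier (obj X n). \<zero>\<^bsub>obj Y n\<^esub>)"

definition kzero :: "('r, 'm) ring_scheme \<Rightarrow> ('r, 'v) cpx \<Rightarrow> ('r, 'v) cpx \<Rightarrow> 'v kmor"
  where "kzero R X Y = homotopy_class R X Y (zero_map X Y)"

lemma zero_map_in_cochain_maps: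
  "X \<in> complexes R \<Longrightarrow> Y \<in> complexes R \<Longrightarrow> zero_map X Y \<in> cochain_maps R X Y"
  by (simp add: cochain_maps_iff zero_map_def lin linear_map_zero[OF complex_diff])

lemma kcomp_kzero:
  assumes X: "X \<in> complexes R" and Y: "Y \<in> complexes R" and Z: "Z \<in> complexes R" and G: "G \<in> KHom R Y Z"
  shows "kcomp R X Z G (kzero R X Y) = kzero R X Z"
proof -
  obtain g where g: "g \<in> cochain_maps R Y Z" "G = homotopy_class R Y Z g"
    using G by (auto elim!: KHom_cases)
  have "comp_maps X g (zero_map X Y) = zero_map X Z"
    using linear_map_zero[OF cochain_map_linear[OF Y Z g(1)]]
    by (auto simp: comp_maps_def compose_def zero_map_def fun_eq_iff)
  then show ?thesis using X Y Z g by (simp add: kzero_def kcomp_homotopy_class zero_map_in_cochain_maps)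
qed


section \<open>Shifts, cones and triangles\<close>

text \<open>Degrees occur inside terms such as \<open>obj X (n + 1 + 1)\<close>, which must coincide
  with \<open>obj X (n + 2)\<close>; the rules fix one normal form for the small offsets that
  arise.\<close>

lemma int_index [simp]:
  fixes n :: int
  shows "1 + n = n + 1" "2 + n = n + 2" "n + 1 + 1 = n + 2" "n + 1 + 2 = n + 3" "n + 2 + 1 = n + 3"
    "n - 1 + 2 = n + 1"
  by simp_all

lemma diff_closed_succ [simp]:
  "X \<in> complexes R \<Longrightarrow> x \<in> carrier (obj X (n + 1)) \<Longrightarrow> diff X (n + 1) x \<in> carrier (obj X (n + 2))"
  by (rule linear_map_closed[OF complex_diff_succ])

lemma linear_map_diff_comp [lin]:
  "\<lbrakk>X \<in> complexes R; linear_map R L (obj X n) g; m = n + 1\<rbrakk> \<Longrightarrow> linear_map R L (obj X m) (\<lambda>x. diff X n (g x))"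
  using linear_map_comp[OF complex_diff] by simp

lemma linear_map_cochain_comp:
  "\<lbrakk>X \<in> complexes R; Y \<in> complexes R; f \<in> cochain_maps R X Y; linear_map R L (obj X n) g\<rbrakk>
    \<Longrightarrow> linear_map R L (obj Y n) (\<lambda>x. f n (g x))"
  by (rule linear_map_comp[OF cochain_map_linear])

lemma right_modules_obj: "X \<in> complexes R \<Longrightarrow> obj X n \<in> right_modules R"
  by (simp add: complexes_def)

lemma diff_extensional: "X \<in> complexes R \<Longrightarrow> diff X n \<in> extensional (carrier (obj X n))"
  unfolding complexes_def module_homs_def PiE_def by blast

section \<open>Shifts\<close>

lemma obj_shift [simp]: "obj (shift n X) k = obj X (k - n)"
  by (simp add: shift_def)

lemma diff_shift_1 [simp]:
  "x \<in> carrier (obj X (k - 1)) \<Longrightarrow> diff (shift 1 X) k x = \<ominus>\<^bsub>obj X k\<^esub> diff X (k - 1) x"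
  by (simp add: shift_def)

lemma diff_shift_m1 [simp]:
  "x \<in> carrier (obj X (k + 1)) \<Longrightarrow> diff (shift (-1) X) k x = \<ominus>\<^bsub>obj X (k + 2)\<^esub> diff X (k + 1) x"
  by (simp add: shift_def)

lemma shift_in_complexes [simp]:
  assumes X: "X \<in> complexes R"
  shows "shift n X \<in> complexes R"
proof (rule complexesI)
  fix k
  show "obj (shift n X) k \<in> right_modules R" using X by (simp add: right_modules_obj)
  have k1: "k + 1 - n = k - n + 1" and k2: "k + 2 - n = k - n + 2" by simp_all
  show "linear_map R (obj (shift n X) k) (obj (shift n X) (k + 1)) (diff (shift n X) k)"
    by (cases "even n") (simp_all add: shift_def k1 lin X)
  show "diff (shift n X) k \<in> extensional (carrier (obj (shift n X) k))"
    by (simp add: shift_def)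
  fix x assume x: "x \<in> carrier (obj (shift n X) k)"
  interpret M: abelian_group "obj X (k - n + 2)" using X by simp
  interpret M: abelian_group "obj X (k - n + 1)" using X by simp
  show "diff (shift n X) (k + 1) (diff (shift n X) k x) = \<zero>\<^bsub>obj (shift n X) (k + 2)\<^esub>"
    using X x by (simp add: shift_def k1 k2 diff_diff linear_map_neg[OF complex_diff[OF X]])
qed

text \<open>The signs cancel and differentials are extensional, so this is an equality of records;
  \<open>shift (-1)\<close> can thus be undone on objects without passing through
  isomorphisms.\<close>

lemma shift_shift:
  assumes X: "X \<in> complexes R"
  shows "shift 1 (shift (-1) X) = X"
proof (rule cpx.equality)
  show "obj (shift 1 (shift (-1) X)) = obj X" by (simp add: fun_eq_iff)
  show "diff (shift 1 (shift (-1) X)) = diff X"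
  proof (intro ext)
    fix k x
    interpret M: abelian_group "obj X (k + 1)" using X by simp
    show "diff (shift 1 (shift (-1) X)) k x = diff X k x"
      using diff_extensional[OF X, of k] diff_closed[OF X, of x k]
      by (auto simp: shift_def extensional_def)
  qed
qed simp

section \<open>Cones and their structure maps\<close>

lemma obj_cone [simp]: "obj (cone R X Y f) n = direct_sum R (obj X (n + 1)) (obj Y n)"
  by (simp add: cone_def)

lemma diff_cone [simp]:
  "\<lbrakk>x \<in> carrier (obj X (n + 1)); y \<in> carrier (obj Y n)\<rbrakk> \<Longrightarrow> diff (cone R X Y f) n (vpair (x, y)) =
    vpair (\<ominus>\<^bsub>obj X (n + 2)\<^esub> diff X (n + 1) x, diff Y n y \<ominus>\<^bsub>obj Y (n + 1)\<^esub> f (n + 1) x)"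
  by (simp add: cone_def)

lemma cone_in_complexes:
  assumes X: "X \<in> complexes R" and Y: "Y \<in> complexes R" and f: "f \<in> cochain_maps R X Y"
  shows "cone R X Y f \<in> complexes R"
proof (rule complexesI)
  fix n
  show "obj (cone R X Y f) n \<in> right_modules R" using X Y by (simp add: right_modules_obj direct_sum_in_right_modules)
  have "linear_map R (direct_sum R (obj X (n + 1)) (obj Y n)) (direct_sum R (obj X (n + 2)) (obj Y (n + 1)))
    (\<lambda>p. vpair (\<ominus>\<^bsub>obj X (n + 2)\<^esub> diff X (n + 1) (vfst p), diff Y n (vsnd p) \<ominus>\<^bsub>obj Y (n + 1)\<^esub> f (n + 1) (vfst p)))"
    by (intro lin linear_map_cochain_comp[OF X Y f] X Y) simp_all
  then show "linear_map R (obj (cone R X Y f) n) (obj (cone R X Y f) (n + 1)) (diff (cone R X Y f) n)"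
    by (simp add: cone_def)
  show "diff (cone R X Y f) n \<in> extensional (carrier (obj (cone R X Y f) n))"
    by (simp add: cone_def)
  fix p assume "p \<in> carrier (obj (cone R X Y f) n)"
  then obtain x y where p: "p = vpair (x, y)" "x \<in> carrier (obj X (n + 1))" "y \<in> carrier (obj Y n)"
    by (auto elim: direct_sum_cases)
  interpret X2: abelian_group "obj X (n + 2)" using X by simp
  interpret X3: abelian_group "obj X (n + 3)" using X by simp
  interpret Y1: abelian_group "obj Y (n + 1)" using Y by simp
  interpret Y2: abelian_group "obj Y (n + 2)" using Y by simp
  have dx: "diff X (n + 1) x \<in> carrier (obj X (n + 2))" using diff_closed[OF X p(2)] by simp
  have fx: "f (n + 1) x \<in> carrier (obj Y (n + 1))" by (rule cochain_map_closed[OF f p(2)])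
  have ddx: "diff X (n + 2) (diff X (n + 1) x) = \<zero>\<^bsub>obj X (n + 3)\<^esub>"
    using diff_diff[OF X p(2)] by simp
  have fdx: "f (n + 2) (diff X (n + 1) x) = diff Y (n + 1) (f (n + 1) x)"
    using cochain_map_diff[OF f p(2)] by simp
  have dfx: "diff Y (n + 1) (f (n + 1) x) \<in> carrier (obj Y (n + 2))"
    using diff_closed[OF Y fx] by simp
  have l1: "diff X (n + 2) (\<ominus>\<^bsub>obj X (n + 2)\<^esub> diff X (n + 1) x) = \<ominus>\<^bsub>obj X (n + 3)\<^esub> diff X (n + 2) (diff X (n + 1) x)"
    using linear_map_neg[OF complex_diff[OF X] dx] by simp
  \<comment> \<open>The second coordinate is \<open>d (d y - f x) - f (- d x)\<close>, which
    vanishes by \<open>d d = 0\<close> and \<open>f d = d f\<close>; the first is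
    \<open>d (d x)\<close> up to sign.\<close>
  show "diff (cone R X Y f) (n + 1) (diff (cone R X Y f) n p) = \<zero>\<^bsub>obj (cone R X Y f) (n + 2)\<^esub>"
    using p dx fx dfx X Y
    by (simp add: linear_map_add[OF complex_diff_succ[OF Y]] linear_map_neg[OF complex_diff_succ[OF Y]] diff_diff linear_map_neg[OF cochain_map_linear[OF X Y f]] fdx
         l1 ddx a_minus_def Y2.l_neg)
qed

lemma complex_zero_closed [simp]: "X \<in> complexes R \<Longrightarrow> \<zero>\<^bsub>obj X n\<^esub> \<in> carrier (obj X n)"
  by (simp add: abelian_groupE(2))

lemma complex_neg_zero [simp]: "X \<in> complexes R \<Longrightarrow> \<ominus>\<^bsub>obj X n\<^esub> \<zero>\<^bsub>obj X n\<^esub> = \<zero>\<^bsub>obj X n\<^esub>"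
  and complex_minus_zero [simp]:
    "\<lbrakk>X \<in> complexes R; x \<in> carrier (obj X n)\<rbrakk> \<Longrightarrow> x \<ominus>\<^bsub>obj X n\<^esub> \<zero>\<^bsub>obj X n\<^esub> = x"
proof -
  assume X: "X \<in> complexes R"
  interpret M: abelian_group "obj X n" using X by simp
  show z: "\<ominus>\<^bsub>obj X n\<^esub> \<zero>\<^bsub>obj X n\<^esub> = \<zero>\<^bsub>obj X n\<^esub>" by simp
  show "x \<ominus>\<^bsub>obj X n\<^esub> \<zero>\<^bsub>obj X n\<^esub> = x" if "x \<in> carrier (obj X n)"
    using that by (simp add: a_minus_def)
qed

lemma cone_inj_in_cochain_maps:
  assumes X: "X \<in> complexes R" and Y: "Y \<in> complexes R" and f: "f \<in> cochain_maps R X Y"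
  shows "cone_inj X Y \<in> cochain_maps R Y (cone R X Y f)"
proof -
  have "f (n + 1) \<zero>\<^bsub>obj X (n + 1)\<^esub> = \<zero>\<^bsub>obj Y (n + 1)\<^esub>"
    "diff X (n + 1) \<zero>\<^bsub>obj X (n + 1)\<^esub> = \<zero>\<^bsub>obj X (n + 2)\<^esub>" for n
    using linear_map_zero[OF cochain_map_linear[OF X Y f]] linear_map_zero[OF complex_diff_succ[OF X]] by simp_all
  then show ?thesis using X Y
    by (simp add: cochain_maps_iff cone_in_complexes f cone_inj_def) (auto intro!: lin)
qed

text \<open>The minus sign in the first coordinate of the cone differential is exactly the sign in
  the differential of \<open>shift (-1) X\<close>.\<close>

lemma cone_proj_in_cochain_maps:
  assumes X: "X \<in> complexes R" and Y: "Y \<in> complexes R" and f: "f \<in> cochain_maps R X Y"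
  shows "cone_proj R X Y \<in> cochain_maps R (cone R X Y f) (shift (-1) X)"
proof -
  have dfx: "f (n + 1) x \<in> carrier (obj Y (n + 1))" if "x \<in> carrier (obj X (n + 1))" for n x
    by (rule cochain_map_closed[OF f that])
  have dx: "\<ominus>\<^bsub>obj X (n + 2)\<^esub> diff X (n + 1) x \<in> carrier (obj X (n + 2))" if "x \<in> carrier (obj X (n + 1))" for n x
  proof -
    interpret X2: abelian_group "obj X (n + 2)" using X by simp
    show ?thesis using diff_closed[OF X that] by simp
  qed
  have dy: "diff Y n y \<ominus>\<^bsub>obj Y (n + 1)\<^esub> f (n + 1) x \<in> carrier (obj Y (n + 1))"
    if "x \<in> carrier (obj X (n + 1))" "y \<in> carrier (obj Y n)" for n x y
  proof -
    interpret Y2: abelian_group "obj Y (n + 1)" using Y by simp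
    show ?thesis using that Y dfx by simp
  qed
  show ?thesis using X Y dx dy
    by (simp add: cochain_maps_iff cone_in_complexes f cone_proj_def ball_direct_sum) (auto intro!: lin)
qed

section \<open>Shifted morphisms and cone triangles\<close>

lemma homotopic_shift_m1:
  assumes X: "X \<in> complexes R" and Y: "Y \<in> complexes R" and fg: "homotopic R X Y f g"
  shows "homotopic R (shift (-1) X) (shift (-1) Y) (\<lambda>k. f (k + 1)) (\<lambda>k. g (k + 1))"
proof -
  obtain s where s: "\<forall>n. linear_map R (obj X n) (obj Y (n - 1)) (s n)"
      "\<forall>n. \<forall>x\<in>carrier (obj X n).
            f n x = g n x \<oplus>\<^bsub>obj Y n\<^esub> (diff Y (n - 1) (s n x) \<oplus>\<^bsub>obj Y n\<^esub> s (n + 1) (diff X n x))"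
    using fg by (auto simp: homotopic_def)
  have s1: "linear_map R (obj X (n + 1)) (obj Y n) (s (n + 1))" for n
    using spec[OF s(1), of "n + 1"] by simp
  \<comment> \<open>Both shifted differentials carry a minus sign, so the homotopy gets one too and
    all products come out positive. The component \<open>s (n + 1)\<close> lands in
    \<open>obj Y n\<close>, which is degree \<open>n - 1\<close> of the shift.\<close>
  define t where "t = (\<lambda>n x. \<ominus>\<^bsub>obj Y n\<^esub> s (n + 1) x)"
  have t: "linear_map R (obj X (n + 1)) (obj Y n) (t n)" for n
    unfolding t_def by (intro lin s1)
  have "f (n + 1) x = g (n + 1) x \<oplus>\<^bsub>obj Y (n + 1)\<^esub> (diff (shift (-1) Y) (n - 1) (t n x)
      \<oplus>\<^bsub>obj Y (n + 1)\<^esub> t (n + 1) (diff (shift (-1) X) n x))"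
    if x: "x \<in> carrier (obj X (n + 1))" for n x
  proof -
    interpret Y0: abelian_group "obj Y n" using Y by simp
    interpret Y1: abelian_group "obj Y (n + 1)" using Y by simp
    interpret X2: abelian_group "obj X (n + 2)" using X by simp
    have sx: "s (n + 1) x \<in> carrier (obj Y n)" by (rule linear_map_closed[OF s1 x])
    have dx: "diff X (n + 1) x \<in> carrier (obj X (n + 2))" using diff_closed[OF X x] by simp
    have sdx: "s (n + 2) (diff X (n + 1) x) \<in> carrier (obj Y (n + 1))"
      using linear_map_closed[OF s1, of "diff X (n + 1) x" "n + 1"] dx by simp
    have "diff (shift (-1) Y) (n - 1) (t n x) = diff Y n (s (n + 1) x)"
      using sx Y diff_shift_m1[of "t n x" Y "n - 1"]
      by (simp add: t_def linear_map_neg[OF complex_diff])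
    moreover have "t (n + 1) (diff (shift (-1) X) n x) = s (n + 2) (diff X (n + 1) x)"
      using x dx sdx linear_map_neg[OF t, of "diff X (n + 1) x" "n + 1"]
      by (simp add: t_def)
    ultimately show ?thesis using s(2) x by simp
  qed
  then show ?thesis using t
    unfolding homotopic_def by (intro exI[of _ t]) simp
qed

lemma cochain_map_shift_m1:
  assumes X: "X \<in> complexes R" and Y: "Y \<in> complexes R" and f: "f \<in> cochain_maps R X Y"
  shows "(\<lambda>k. f (k + 1)) \<in> cochain_maps R (shift (-1) X) (shift (-1) Y)"
proof -
  have "f (n + 2) (\<ominus>\<^bsub>obj X (n + 2)\<^esub> diff X (n + 1) x) = \<ominus>\<^bsub>obj Y (n + 2)\<^esub> diff Y (n + 1) (f (n + 1) x)"
    if x: "x \<in> carrier (obj X (n + 1))" for n x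
    using linear_map_neg[OF cochain_map_linear[OF X Y f]] diff_closed[OF X x] cochain_map_diff[OF f x]
    by simp
  then show ?thesis using X Y f
    by (simp add: cochain_maps_iff[of "shift (-1) X"] cochain_map_linear cochain_map_extensional
        cochain_map_closed)
qed

text \<open>This settles the third square of a comparison of triangles whose isomorphism on
  \<open>X\<close> is the identity. The members of \<open>kshift (-1) (kid R X)\<close> are all
  homotopic to the identity of the shift, so \<open>kcomp_eqI\<close> applies.\<close>

lemma kshift_kid_comp:
  assumes X: "X \<in> complexes R" and Y: "Y \<in> complexes R" and H: "H \<in> KHom R Y (shift (-1) X)"
  shows "kcomp R Y (shift (-1) X) (kshift (-1) (kid R X)) H = H"
proof -
  let ?S = "shift (-1) X"
  have S: "?S \<in> complexes R" using X by simp
  have "g \<in> homotopy_class R ?S ?S (id_map ?S)" if g: "g \<in> kshift (-1) (kid R X)" for g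
  proof -
    obtain f where f: "f \<in> cochain_maps R X X" "homotopic R X X (id_map X) f" "g = (\<lambda>k. f (k + 1))"
      using g X by (auto simp: kshift_def kid_eq in_homotopy_class_iff id_map_in_cochain_maps)
    have "g \<in> cochain_maps R ?S ?S"
      using cochain_map_shift_m1[OF X X f(1)] f(3) by simp
    moreover have "homotopic R ?S ?S (id_map ?S) g"
      using homotopic_shift_m1[OF X X f(2)] f(3) by (simp add: id_map_def)
    ultimately show ?thesis by (simp add: in_homotopy_class_iff[OF S S id_map_in_cochain_maps[OF S]])
  qed
  moreover have "kshift (-1) (kid R X) \<noteq> {}"
    using in_homotopy_class_self[OF X X id_map_in_cochain_maps[OF X]] by (auto simp: kshift_def kid_eq)
  moreover obtain h where h: "h \<in> cochain_maps R Y ?S" "H = homotopy_class R Y ?S h"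
    using H by (rule KHom_cases)
  ultimately show ?thesis
    using kcomp_eqI[OF Y S S h(1) id_map_in_cochain_maps[OF S], of "kshift (-1) (kid R X)"]
    by (auto simp: id_map_comp)
qed

text \<open>An isomorphic copy \<open>Y'\<close> of the target is allowed because the morphisms
  built later have a known cone only after composition with \<open>B\<close>. The comparison with
  the standard triangle is the identity on \<open>X\<close>, \<open>B\<close> on \<open>Y\<close>
  and the identity on the cone.\<close>

lemma exact_triangle_cone:
  assumes X: "X \<in> complexes R" and Y: "Y \<in> complexes R" and Y': "Y' \<in> complexes R"
    and f: "f \<in> cochain_maps R X Y'" and F: "F \<in> KHom R X Y" and B: "B \<in> kisos R Y Y'"
    and BF: "kcomp R X Y' B F = homotopy_class R X Y' f"
  shows "\<exists>G H. exact_triangle R X Y (cone R X Y' f) F G H"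
proof -
  let ?C = "cone R X Y' f"
  let ?i = "homotopy_class R Y' ?C (cone_inj X Y')"
  let ?p = "homotopy_class R ?C (shift (-1) X) (cone_proj R X Y')"
  have C: "?C \<in> complexes R" by (rule cone_in_complexes[OF X Y' f])
  have i: "?i \<in> KHom R Y' ?C" by (intro homotopy_class_in_KHom cone_inj_in_cochain_maps X Y' f)
  have p: "?p \<in> KHom R ?C (shift (-1) X)" by (intro homotopy_class_in_KHom cone_proj_in_cochain_maps X Y' f)
  have B': "B \<in> KHom R Y Y'" using B by (simp add: kisos_def)
  have iB: "kcomp R Y ?C ?i B \<in> KHom R Y ?C" by (rule kcomp_closed[OF Y Y' C B' i])
  have "exact_triangle R X Y ?C F (kcomp R Y ?C ?i B) ?p"
    unfolding exact_triangle_def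
    by (intro conjI X Y C F iB p, rule bexI[OF _ X], rule bexI[OF _ Y'], rule bexI[OF _ f],
        rule bexI[OF _ kid_in_kisos[OF X]], rule bexI[OF _ B], rule bexI[OF _ kid_in_kisos[OF C]])
      (simp add: C X BF kcomp_kid[OF X Y' homotopy_class_in_KHom[OF f]] kcomp_kid[OF Y C iB]
        kcomp_kid[OF C _ p] kshift_kid_comp[OF X C p])
  then show ?thesis by blast
qed


section \<open>Homotopy fibers\<close>

text \<open>The fiber is taken to be a shifted cone so that subcategories closed under cones and shifts contain it.\<close>

definition fiber ::
    "('r, 'm) ring_scheme \<Rightarrow> ('r, 'v::universe) cpx \<Rightarrow> ('r, 'v) cpx \<Rightarrow> (int \<Rightarrow> 'v \<Rightarrow> 'v) \<Rightarrow> ('r, 'v) cpx"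
  where "fiber R X Y f = shift 1 (cone R X Y f)"

definition fiber_proj ::
    "('r, 'm) ring_scheme \<Rightarrow> ('r, 'v::universe) cpx \<Rightarrow> ('r, 'v) cpx \<Rightarrow> int \<Rightarrow> 'v \<Rightarrow> 'v"
  where "fiber_proj R X Y n = (\<lambda>p\<in>carrier (direct_sum R (obj X n) (obj Y (n - 1))). vfst p)"

lemma obj_fiber [simp]: "obj (fiber R X Y f) n = direct_sum R (obj X n) (obj Y (n - 1))"
  by (simp add: fiber_def)

lemma fiber_in_complexes:
  "\<lbrakk>X \<in> complexes R; Y \<in> complexes R; f \<in> cochain_maps R X Y\<rbrakk> \<Longrightarrow> fiber R X Y f \<in> complexes R"
  by (simp add: fiber_def cone_in_complexes)

lemma (in abelian_group) neg_minus: "\<lbrakk>x \<in> carrier G; y \<in> carrier G\<rbrakk> \<Longrightarrow> \<ominus> (x \<ominus> y) = y \<ominus> x"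
  by (simp add: a_minus_def minus_add a_comm)

text \<open>The sign of the shift cancels the minus in the first coordinate of the cone and reverses
  the difference in the second. Hence \<open>fiber_proj\<close> commutes with the differentials
  without any sign.\<close>

lemma diff_fiber [simp]:
  assumes X: "X \<in> complexes R" and Y: "Y \<in> complexes R" and f: "f \<in> cochain_maps R X Y"
    and x: "x \<in> carrier (obj X n)" and y: "y \<in> carrier (obj Y (n - 1))"
  shows "diff (fiber R X Y f) n (vpair (x, y)) =
    vpair (diff X n x, f n x \<ominus>\<^bsub>obj Y n\<^esub> diff Y (n - 1) y)"
proof -
  interpret X1: abelian_group "obj X (n + 1)" using X by simp
  interpret Y0: abelian_group "obj Y n" using Y by simp
  have "diff (cone R X Y f) (n - 1) (vpair (x, y)) =
     vpair (\<ominus>\<^bsub>obj X (n + 1)\<^esub> diff X n x, diff Y (n - 1) y \<ominus>\<^bsub>obj Y n\<^esub> f n x)"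
    using diff_cone[of x X "n - 1" y Y R f] x y by simp
  then show ?thesis using X Y x y cochain_map_closed[OF f x]
    by (simp add: fiber_def neg_direct_sum[where R=R] Y0.neg_minus)
qed

lemma fiber_proj_in_cochain_maps:
  assumes X: "X \<in> complexes R" and Y: "Y \<in> complexes R" and f: "f \<in> cochain_maps R X Y"
  shows "fiber_proj R X Y \<in> cochain_maps R (fiber R X Y f) X"
proof -
  have "f n x \<ominus>\<^bsub>obj Y n\<^esub> diff Y (n - 1) y \<in> carrier (obj Y n)"
    if "x \<in> carrier (obj X n)" "y \<in> carrier (obj Y (n - 1))" for n x y
  proof -
    interpret Y: abelian_group "obj Y n" using Y by simp
    show ?thesis using that Y cochain_map_closed[OF f] by simp
  qed
  then show ?thesis using assms
    by (simp add: cochain_maps_iff fiber_in_complexes fiber_proj_def ball_direct_sum) (auto intro: lin)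
qed

text \<open>The second coordinate is itself a null homotopy:
  \<open>d y + (f x - d y) = f x\<close>.\<close>

lemma fiber_proj_null:
  assumes X: "X \<in> complexes R" and Y: "Y \<in> complexes R" and f: "f \<in> cochain_maps R X Y"
  shows "homotopic R (fiber R X Y f) Y (comp_maps (fiber R X Y f) f (fiber_proj R X Y)) (zero_map (fiber R X Y f) Y)"
proof -
  have "f n x = \<zero>\<^bsub>obj Y n\<^esub> \<oplus>\<^bsub>obj Y n\<^esub> (diff Y (n - 1) y \<oplus>\<^bsub>obj Y n\<^esub> (f n x \<ominus>\<^bsub>obj Y n\<^esub> diff Y (n - 1) y))"
    if "x \<in> carrier (obj X n)" "y \<in> carrier (obj Y (n - 1))" for n x y
  proof -
    interpret Y: abelian_group "obj Y n" using Y by simp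
    have "f n x \<in> carrier (obj Y n)" "diff Y (n - 1) y \<in> carrier (obj Y n)"
      using that Y cochain_map_closed[OF f] by simp_all
    then show ?thesis by (simp add: a_minus_def Y.a_ac Y.r_neg)
  qed
  then show ?thesis using assms
    unfolding homotopic_def
    by (intro exI[of _ "\<lambda>n. vsnd"]) (simp add: ball_direct_sum fiber_proj_def zero_map_def lin)
qed

section \<open>The cofiber and its symmetry\<close>

definition swap_map ::
    "('r, 'v) cpx \<Rightarrow> int \<Rightarrow> 'v \<Rightarrow> 'v::universe"
  where "swap_map X n = (\<lambda>p\<in>carrier (obj X n). vpair (vpair (vfst (vfst p), vsnd p), vsnd (vfst p)))"

text \<open>
  The cone of \<open>W \<rightarrow> Z \<rightarrow> X\<close>, where \<open>W\<close> is the fiber of \<open>b\<close>. Up to the order of summands it is symmetric in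
  \<open>f\<close> and \<open>b\<close>, which replaces the octahedral axiom.
\<close>

definition cofiber ::
    "('r, 'm) ring_scheme \<Rightarrow> ('r, 'v::universe) cpx \<Rightarrow> ('r, 'v) cpx \<Rightarrow> ('r, 'v) cpx
      \<Rightarrow> (int \<Rightarrow> 'v \<Rightarrow> 'v) \<Rightarrow> (int \<Rightarrow> 'v \<Rightarrow> 'v) \<Rightarrow> ('r, 'v) cpx"
  where "cofiber R Z X K f b =
    cone R (fiber R Z K b) X (comp_maps (fiber R Z K b) f (fiber_proj R Z K))"

lemma comp_fiber_proj_in_cochain_maps:
  assumes "Z \<in> complexes R" "X \<in> complexes R" "K \<in> complexes R"
    and "f \<in> cochain_maps R Z X" "b \<in> cochain_maps R Z K"
  shows "comp_maps (fiber R Z K b) f (fiber_proj R Z K) \<in> cochain_maps R (fiber R Z K b) X"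
  using assms by (intro cochain_maps_comp[of _ R Z X] fiber_in_complexes fiber_proj_in_cochain_maps)

lemma cofiber_in_complexes:
  assumes "Z \<in> complexes R" "X \<in> complexes R" "K \<in> complexes R"
    and "f \<in> cochain_maps R Z X" "b \<in> cochain_maps R Z K"
  shows "cofiber R Z X K f b \<in> complexes R"
  using assms unfolding cofiber_def
  by (intro cone_in_complexes comp_fiber_proj_in_cochain_maps fiber_in_complexes)

lemma obj_cofiber [simp]:
  "obj (cofiber R Z X K f b) n = direct_sum R (direct_sum R (obj Z (n + 1)) (obj K n)) (obj X n)"
  by (simp add: cofiber_def)

text \<open>The minus in the first coordinate of the outer cone turns \<open>b z - d k\<close> into
  \<open>d k - b z\<close>. The coordinates \<open>k\<close> and \<open>x\<close> then follow the
  same rule with the same sign, so the plain transposition of the two is a cochain map.\<close>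

lemma diff_cofiber [simp]:
  assumes Z: "Z \<in> complexes R" and X: "X \<in> complexes R" and K: "K \<in> complexes R"
    and f: "f \<in> cochain_maps R Z X" and b: "b \<in> cochain_maps R Z K"
    and z: "z \<in> carrier (obj Z (n + 1))" and k: "k \<in> carrier (obj K n)" and x: "x \<in> carrier (obj X n)"
  shows "diff (cofiber R Z X K f b) n (vpair (vpair (z, k), x)) =
    vpair (vpair (\<ominus>\<^bsub>obj Z (n + 2)\<^esub> diff Z (n + 1) z, diff K n k \<ominus>\<^bsub>obj K (n + 1)\<^esub> b (n + 1) z),
      diff X n x \<ominus>\<^bsub>obj X (n + 1)\<^esub> f (n + 1) z)"
proof -
  interpret K1: abelian_group "obj K (n + 1)" using K by simp
  have "diff (fiber R Z K b) (n + 1) (vpair (z, k)) =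
     vpair (diff Z (n + 1) z, b (n + 1) z \<ominus>\<^bsub>obj K (n + 1)\<^esub> diff K n k)"
    using diff_fiber[OF Z K b z, of k] k by simp
  then show ?thesis using Z X K x z k cochain_map_closed[OF b z]
    by (simp add: cofiber_def neg_direct_sum[where R=R] K1.neg_minus fiber_proj_def)
qed

lemma swap_map_in_cochain_maps:
  assumes Z: "Z \<in> complexes R" and X: "X \<in> complexes R" and K: "K \<in> complexes R"
    and f: "f \<in> cochain_maps R Z X" and b: "b \<in> cochain_maps R Z K"
  shows "swap_map (cofiber R Z X K f b) \<in> cochain_maps R (cofiber R Z X K f b) (cofiber R Z K X b f)"
proof -
  let ?W = "\<lambda>n. direct_sum R (obj Z (n + 1)) (obj K n)"
  let ?C = "\<lambda>n. direct_sum R (?W n) (obj X n)"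
  have W: "right_module R (?W n)" for n using Z K by (intro lin)
  have C: "linear_map R (?C n) (?W n) vfst" for n by (rule linear_map_vfst[OF W complex_module[OF X]])
  have "linear_map R (?C n) (obj Z (n + 1)) (\<lambda>p. vfst (vfst p))" for n
    by (rule linear_map_comp[OF _ C]) (use Z K in \<open>intro lin\<close>)
  moreover have "linear_map R (?C n) (obj K n) (\<lambda>p. vsnd (vfst p))" for n
    by (rule linear_map_comp[OF _ C]) (use Z K in \<open>intro lin\<close>)
  moreover have "linear_map R (?C n) (obj X n) vsnd" for n by (rule linear_map_vsnd[OF W complex_module[OF X]])
  ultimately have "linear_map R (?C n) (direct_sum R (direct_sum R (obj Z (n + 1)) (obj X n)) (obj K n))
    (\<lambda>p. vpair (vpair (vfst (vfst p), vsnd p), vsnd (vfst p)))" for n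
    by (intro linear_map_vpair)
  moreover have "\<ominus>\<^bsub>obj Z (n + 2)\<^esub> diff Z (n + 1) z \<in> carrier (obj Z (n + 2))"
    if "z \<in> carrier (obj Z (n + 1))" for n z
  proof -
    interpret Z: abelian_group "obj Z (n + 2)" using Z by simp
    show ?thesis using that Z by simp
  qed
  moreover have d: "diff Y n y \<ominus>\<^bsub>obj Y (n + 1)\<^esub> g (n + 1) z \<in> carrier (obj Y (n + 1))"
    if "Y \<in> complexes R" "g \<in> cochain_maps R Z Y" "z \<in> carrier (obj Z (n + 1))" "y \<in> carrier (obj Y n)"
      for Y :: "('a, 'b) cpx" and g n y z
  proof -
    interpret Y: abelian_group "obj Y (n + 1)" using that by simp
    show ?thesis using that cochain_map_closed[OF that(2,3)] by simp
  qed
  ultimately show ?thesis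
    by (simp add: cochain_maps_iff[OF cofiber_in_complexes[OF assms] cofiber_in_complexes[OF Z K X b f]] assms
      ball_direct_sum swap_map_def d[OF X f] d[OF K b])
qed

text \<open>Two transpositions give the identity already as cochain maps, before passing to homotopy
  classes.\<close>

lemma cofiber_swap:
  assumes Z: "Z \<in> complexes R" and X: "X \<in> complexes R" and K: "K \<in> complexes R"
    and f: "f \<in> cochain_maps R Z X" and b: "b \<in> cochain_maps R Z K"
  shows "kisos R (cofiber R Z X K f b) (cofiber R Z K X b f) \<noteq> {}"
proof -
  let ?C = "cofiber R Z X K f b" and ?D = "cofiber R Z K X b f"
  note C = cofiber_in_complexes[OF Z X K f b] and D = cofiber_in_complexes[OF Z K X b f]
  note s = swap_map_in_cochain_maps[OF Z X K f b] and t = swap_map_in_cochain_maps[OF Z K X b f]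
  have 1: "comp_maps ?C (swap_map ?D) (swap_map ?C) = id_map ?C"
    by (auto simp: fun_eq_iff comp_maps_def compose_def swap_map_def id_map_def elim!: direct_sum_cases)
  have 2: "comp_maps ?D (swap_map ?C) (swap_map ?D) = id_map ?D"
    by (auto simp: fun_eq_iff comp_maps_def compose_def swap_map_def id_map_def elim!: direct_sum_cases)
  have "homotopy_class R ?C ?D (swap_map ?C) \<in> kisos R ?C ?D"
    unfolding kisos_def
    by (intro CollectI conjI homotopy_class_in_KHom s bexI[OF _ homotopy_class_in_KHom[OF t]])
      (simp_all add: kcomp_homotopy_class C D s t 1 2 kid_eq)
  then show ?thesis by blast
qed

section \<open>Lifting through cones and fibers\<close>

text \<open>A null homotopy into the cone has coordinates \<open>s1\<close> in \<open>X\<close> and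
  \<open>s2\<close> in \<open>Y\<close>. The first coordinate of its identity says that
  \<open>s1\<close> commutes with the differentials, the second reads
  \<open>t = d s2 - f s1 + s2 d\<close>. So \<open>s2\<close> is a homotopy from \<open>t\<close> to
  \<open>f v\<close> with \<open>v = - s1\<close>.\<close>

lemma cone_inj_weak_kernel:
  assumes W: "W \<in> complexes R" and X: "X \<in> complexes R" and Y: "Y \<in> complexes R"
    and f: "f \<in> cochain_maps R X Y" and t: "t \<in> cochain_maps R W Y"
    and null: "homotopic R W (cone R X Y f) (comp_maps W (cone_inj X Y) t) (zero_map W (cone R X Y f))"
  shows "\<exists>v\<in>cochain_maps R W X. homotopic R W Y t (comp_maps W f v)"
proof -
  let ?C = "cone R X Y f"
  have C: "?C \<in> complexes R" by (rule cone_in_complexes[OF X Y f])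
  obtain s where s: "\<forall>n. linear_map R (obj W n) (obj ?C (n - 1)) (s n)"
    and eq: "\<forall>n. \<forall>x\<in>carrier (obj W n). comp_maps W (cone_inj X Y) t n x =
      zero_map W ?C n x \<oplus>\<^bsub>obj ?C n\<^esub> (diff ?C (n - 1) (s n x) \<oplus>\<^bsub>obj ?C n\<^esub> s (n + 1) (diff W n x))"
    using null unfolding homotopic_def by blast
  define s1 where "s1 = (\<lambda>n x. vfst (s n x))"
  define s2 where "s2 = (\<lambda>n x. vsnd (s n x))"
  \<comment> \<open>A homotopy lowers degrees by one and the cone takes \<open>X\<close> one degree
    higher, so the \<open>X\<close> coordinate of \<open>s n\<close> preserves degrees.\<close>
  have s': "linear_map R (obj W n) (direct_sum R (obj X n) (obj Y (n - 1))) (s n)" for n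
    using spec[OF s, of n] by simp
  have s1: "linear_map R (obj W n) (obj X n) (s1 n)" for n
    unfolding s1_def by (rule linear_map_comp[OF linear_map_vfst s']) (use X Y in simp_all)
  have s2: "linear_map R (obj W n) (obj Y (n - 1)) (s2 n)" for n
    unfolding s2_def by (rule linear_map_comp[OF linear_map_vsnd s']) (use X Y in simp_all)
  have s_eq: "s n x = vpair (s1 n x, s2 n x)" if "x \<in> carrier (obj W n)" for n x
    using linear_map_closed[OF s' that] by (auto simp: s1_def s2_def elim: direct_sum_cases)
  have comps: "\<ominus>\<^bsub>obj X (n + 1)\<^esub> diff X n (s1 n x) \<oplus>\<^bsub>obj X (n + 1)\<^esub> s1 (n + 1) (diff W n x) = \<zero>\<^bsub>obj X (n + 1)\<^esub>"
    "t n x = (diff Y (n - 1) (s2 n x) \<ominus>\<^bsub>obj Y n\<^esub> f n (s1 n x)) \<oplus>\<^bsub>obj Y n\<^esub> s2 (n + 1) (diff W n x)"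
    if x: "x \<in> carrier (obj W n)" for n x
  proof -
    interpret X1: abelian_group "obj X (n + 1)" using X by simp
    interpret Y0: abelian_group "obj Y n" using Y by simp
    have dx: "diff W n x \<in> carrier (obj W (n + 1))" using W x by simp
    have c: "s1 n x \<in> carrier (obj X n)" "s2 n x \<in> carrier (obj Y (n - 1))"
      "s1 (n + 1) (diff W n x) \<in> carrier (obj X (n + 1))" "s2 (n + 1) (diff W n x) \<in> carrier (obj Y n)"
      "t n x \<in> carrier (obj Y n)"
      using linear_map_closed[OF s1 x] linear_map_closed[OF s2 x] linear_map_closed[OF s1 dx]
        linear_map_closed[OF s2 dx] cochain_map_closed[OF t x] by simp_all
    have fc: "f n (s1 n x) \<in> carrier (obj Y n)" by (rule cochain_map_closed[OF f c(1)])
    have dc: "\<ominus>\<^bsub>obj X (n + 1)\<^esub> diff X n (s1 n x) \<in> carrier (obj X (n + 1))"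
      "diff Y (n - 1) (s2 n x) \<ominus>\<^bsub>obj Y n\<^esub> f n (s1 n x) \<in> carrier (obj Y n)"
      using c fc X Y by simp_all
    have "diff ?C (n - 1) (s n x) =
      vpair (\<ominus>\<^bsub>obj X (n + 1)\<^esub> diff X n (s1 n x), diff Y (n - 1) (s2 n x) \<ominus>\<^bsub>obj Y n\<^esub> f n (s1 n x))"
      using diff_cone[of "s1 n x" X "n - 1" "s2 n x" Y R f] c by (simp add: s_eq[OF x])
    then have "vpair (\<zero>\<^bsub>obj X (n + 1)\<^esub>, t n x) =
       vpair (\<ominus>\<^bsub>obj X (n + 1)\<^esub> diff X n (s1 n x) \<oplus>\<^bsub>obj X (n + 1)\<^esub> s1 (n + 1) (diff W n x),
         (diff Y (n - 1) (s2 n x) \<ominus>\<^bsub>obj Y n\<^esub> f n (s1 n x)) \<oplus>\<^bsub>obj Y n\<^esub> s2 (n + 1) (diff W n x))"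
      using bspec[OF spec[OF eq] x] x c fc dc X Y s_eq[OF dx] by (simp add: zero_map_def cone_inj_def)
    then show "\<ominus>\<^bsub>obj X (n + 1)\<^esub> diff X n (s1 n x) \<oplus>\<^bsub>obj X (n + 1)\<^esub> s1 (n + 1) (diff W n x) = \<zero>\<^bsub>obj X (n + 1)\<^esub>"
    "t n x = (diff Y (n - 1) (s2 n x) \<ominus>\<^bsub>obj Y n\<^esub> f n (s1 n x)) \<oplus>\<^bsub>obj Y n\<^esub> s2 (n + 1) (diff W n x)"
      by auto
  qed
  define v where "v = (\<lambda>n. \<lambda>x\<in>carrier (obj W n). \<ominus>\<^bsub>obj X n\<^esub> s1 n x)"
  have "linear_map R (obj W n) (obj X n) (v n)" for n
    unfolding v_def linear_map_restrict by (intro lin s1)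
  moreover have "v (n + 1) (diff W n x) = diff X n (v n x)" if x: "x \<in> carrier (obj W n)" for n x
  proof -
    interpret X1: abelian_group "obj X (n + 1)" using X by simp
    have dx: "diff W n x \<in> carrier (obj W (n + 1))" using W x by simp
    have c: "diff X n (s1 n x) \<in> carrier (obj X (n + 1))" "s1 (n + 1) (diff W n x) \<in> carrier (obj X (n + 1))"
      using linear_map_closed[OF s1 x] linear_map_closed[OF s1 dx] X by simp_all
    then have "s1 (n + 1) (diff W n x) = diff X n (s1 n x)"
      using comps(1)[OF x] X1.minus_equality X1.minus_minus X1.a_inv_closed by metis
    then show ?thesis
      using x dx by (simp add: v_def linear_map_neg[OF complex_diff[OF X] linear_map_closed[OF s1 x]])
  qed
  ultimately have v: "v \<in> cochain_maps R W X" by (simp add: cochain_maps_iff[OF W X]) (simp add: v_def)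
  have "t n x = comp_maps W f v n x \<oplus>\<^bsub>obj Y n\<^esub> (diff Y (n - 1) (s2 n x) \<oplus>\<^bsub>obj Y n\<^esub> s2 (n + 1) (diff W n x))"
    if x: "x \<in> carrier (obj W n)" for n x
  proof -
    interpret Y0: abelian_group "obj Y n" using Y by simp
    have dx: "diff W n x \<in> carrier (obj W (n + 1))" using W x by simp
    have "diff Y (n - 1) (s2 n x) \<in> carrier (obj Y n)" "s2 (n + 1) (diff W n x) \<in> carrier (obj Y n)"
      "f n (s1 n x) \<in> carrier (obj Y n)"
      using linear_map_closed[OF s2 x] linear_map_closed[OF s2 dx] cochain_map_closed[OF f linear_map_closed[OF s1 x]] Y by simp_all
    then show ?thesis
      using x by (simp add: comps(2) v_def linear_map_neg[OF cochain_map_linear[OF X Y f] linear_map_closed[OF s1 x]]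
        a_minus_def Y0.a_ac)
  qed
  then have "homotopic R W Y t (comp_maps W f v)"
    unfolding homotopic_def using s2 by blast
  then show ?thesis using v by blast
qed

text \<open>The lift is \<open>(f - g, s)\<close> for a homotopy \<open>s\<close> from
  \<open>i f\<close> to \<open>i g\<close>. Its compatibility with the fiber differential in the
  second coordinate, \<open>i (f - g) - d s = s d\<close>, is the homotopy identity. The difference
  is recorded pointwise, as only cochain maps are subtracted here.\<close>

lemma fiber_lift:
  assumes W: "W \<in> complexes R" and Y: "Y \<in> complexes R" and E: "E \<in> complexes R"
    and i: "i \<in> cochain_maps R Y E" and f: "f \<in> cochain_maps R W Y" and g: "g \<in> cochain_maps R W Y"
    and h: "homotopic R W E (comp_maps W i f) (comp_maps W i g)"
  shows "\<exists>q\<in>cochain_maps R W (fiber R Y E i). \<forall>n. \<forall>x\<in>carrier (obj W n). vfst (q n x) = f n x \<ominus>\<^bsub>obj Y n\<^esub> g n x"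
proof -
  let ?F = "fiber R Y E i"
  have F: "?F \<in> complexes R" by (rule fiber_in_complexes[OF Y E i])
  obtain s where s: "\<forall>n. linear_map R (obj W n) (obj E (n - 1)) (s n)"
    and eq: "\<forall>n. \<forall>x\<in>carrier (obj W n). comp_maps W i f n x =
      comp_maps W i g n x \<oplus>\<^bsub>obj E n\<^esub> (diff E (n - 1) (s n x) \<oplus>\<^bsub>obj E n\<^esub> s (n + 1) (diff W n x))"
    using h unfolding homotopic_def by blast
  define q where "q = (\<lambda>n. \<lambda>x\<in>carrier (obj W n). vpair (f n x \<ominus>\<^bsub>obj Y n\<^esub> g n x, s n x))"
  have "linear_map R (obj W n) (obj ?F n) (q n)" for n
    unfolding q_def linear_map_restrict obj_fiber
    by (intro lin spec[OF s] cochain_map_linear[OF W Y f] cochain_map_linear[OF W Y g])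
  moreover have "q (n + 1) (diff W n x) = diff ?F n (q n x)" if x: "x \<in> carrier (obj W n)" for n x
  proof -
    interpret E: abelian_group "obj E n" using E by simp
    interpret Y: abelian_group "obj Y n" using Y by simp
    have dx: "diff W n x \<in> carrier (obj W (n + 1))" using W x by simp
    have c: "s n x \<in> carrier (obj E (n - 1))" "s (n + 1) (diff W n x) \<in> carrier (obj E n)"
      "f n x \<in> carrier (obj Y n)" "g n x \<in> carrier (obj Y n)"
      using linear_map_closed[OF spec[OF s] x] linear_map_closed[OF spec[OF s] dx]
        cochain_map_closed[OF f x] cochain_map_closed[OF g x] by simp_all
    have c': "i n (f n x) \<in> carrier (obj E n)" "i n (g n x) \<in> carrier (obj E n)" "diff E (n - 1) (s n x) \<in> carrier (obj E n)"
      using cochain_map_closed[OF i] c E by simp_all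
    have "i n (f n x) \<ominus>\<^bsub>obj E n\<^esub> i n (g n x) = diff E (n - 1) (s n x) \<oplus>\<^bsub>obj E n\<^esub> s (n + 1) (diff W n x)"
      using E.minus_eq_iff[OF c'(1,2)] eq x c c' by simp
    then have "i n (f n x \<ominus>\<^bsub>obj Y n\<^esub> g n x) \<ominus>\<^bsub>obj E n\<^esub> diff E (n - 1) (s n x) = s (n + 1) (diff W n x)"
      using E.minus_eq_iff[of "i n (f n x) \<ominus>\<^bsub>obj E n\<^esub> i n (g n x)"] c c' linear_map_diff[OF cochain_map_linear[OF Y E i] c(3,4)]
      by simp
    then show ?thesis
      using x dx c Y E by (simp add: q_def i linear_map_diff[OF complex_diff[OF Y]] cochain_map_diff[OF f] cochain_map_diff[OF g])
  qed
  ultimately have "q \<in> cochain_maps R W ?F" by (simp add: cochain_maps_iff[OF W F]) (simp add: q_def)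
  moreover have "\<forall>n. \<forall>x\<in>carrier (obj W n). vfst (q n x) = f n x \<ominus>\<^bsub>obj Y n\<^esub> g n x" by (simp add: q_def)
  ultimately show ?thesis by blast
qed

text \<open>The counterpart of \<open>fiber_lift\<close>: it turns a null-homotopic pointwise
  difference back into an equality of homotopy classes.\<close>

lemma homotopic_if_difference_null:
  assumes X: "X \<in> complexes R" and Y: "Y \<in> complexes R"
    and f: "f \<in> cochain_maps R X Y" and g: "g \<in> cochain_maps R X Y"
    and h: "homotopic R X Y h (zero_map X Y)"
    and eq: "\<And>n x. x \<in> carrier (obj X n) \<Longrightarrow> h n x = f n x \<ominus>\<^bsub>obj Y n\<^esub> g n x"
  shows "homotopic R X Y f g"
proof -
  obtain s where s: "\<forall>n. linear_map R (obj X n) (obj Y (n - 1)) (s n)"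
    and h: "\<forall>n. \<forall>x\<in>carrier (obj X n). h n x =
      zero_map X Y n x \<oplus>\<^bsub>obj Y n\<^esub> (diff Y (n - 1) (s n x) \<oplus>\<^bsub>obj Y n\<^esub> s (n + 1) (diff X n x))"
    using h unfolding homotopic_def by blast
  have "f n x = g n x \<oplus>\<^bsub>obj Y n\<^esub> (diff Y (n - 1) (s n x) \<oplus>\<^bsub>obj Y n\<^esub> s (n + 1) (diff X n x))"
    if x: "x \<in> carrier (obj X n)" for n x
  proof -
    interpret Y: abelian_group "obj Y n" using Y by simp
    have "diff Y (n - 1) (s n x) \<in> carrier (obj Y n)" "s (n + 1) (diff X n x) \<in> carrier (obj Y n)"
      using linear_map_closed[OF spec[OF s] x] linear_map_closed[OF spec[OF s], of "diff X n x" "n + 1"] x X Y by simp_all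
    then show ?thesis
      using h x eq[OF x] Y.minus_eq_iff[OF cochain_map_closed[OF f x] cochain_map_closed[OF g x],
          of "diff Y (n - 1) (s n x) \<oplus>\<^bsub>obj Y n\<^esub> s (n + 1) (diff X n x)"]
        cochain_map_closed[OF f x] cochain_map_closed[OF g x]
      by (simp add: zero_map_def)
  qed
  then show ?thesis unfolding homotopic_def using s by blast
qed


section \<open>Morphisms with cone in a triangulated subcategory\<close>

lemma kisos_KHom: "F \<in> kisos R X Y \<Longrightarrow> F \<in> KHom R X Y"
  by (simp add: kisos_def)

lemma kiso_inverse:
  assumes "F \<in> kisos R X Y"
  obtains G where "G \<in> kisos R Y X" "kcomp R X X G F = kid R X" "kcomp R Y Y F G = kid R Y"
  using assms unfolding kisos_def by blast

text \<open>Serves to carry equations proved for cone representatives back to the original objects,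
  by applying an inverse of \<open>B\<close>.\<close>

lemma kiso_cancel:
  assumes W: "W \<in> complexes R" and X: "X \<in> complexes R" and Y: "Y \<in> complexes R"
    and B: "B \<in> kisos R X Y" and F: "F \<in> KHom R W X" and G: "G \<in> KHom R W X"
    and eq: "kcomp R W Y B F = kcomp R W Y B G"
  shows "F = G"
proof -
  obtain C where C: "C \<in> KHom R Y X" "kcomp R X X C B = kid R X"
    using B kiso_inverse kisos_KHom by metis
  have "kcomp R W X C (kcomp R W Y B H) = H" if "H \<in> KHom R W X" for H
    using kcomp_assoc[OF W X Y X that kisos_KHom[OF B] C(1)] C(2) kcomp_kid[OF W X that] by simp
  then show ?thesis using F G eq by metis
qed

lemma triangulated_subcat_kisos:
  "\<lbrakk>triangulated_subcat R T D; X \<in> D; Y \<in> T; F \<in> kisos R X Y\<rbrakk> \<Longrightarrow> Y \<in> D"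
  unfolding triangulated_subcat_def by blast

lemma triangulated_subcat_shift:
  assumes "triangulated_subcat R T D" and "D \<subseteq> complexes R" and "X \<in> D"
  shows "shift 1 X \<in> D"
proof -
  obtain X' where "X = shift (-1) X'" "X' \<in> D"
    using assms unfolding triangulated_subcat_def by blast
  then show ?thesis using shift_shift assms(2) by (metis subsetD)
qed

lemma triangulated_subcat_cone:
  assumes D: "triangulated_subcat R T D" and "D \<subseteq> complexes R" and X: "X \<in> D" and Y: "Y \<in> D"
    and f: "f \<in> cochain_maps R X Y" and cone: "cone R X Y f \<in> T"
  shows "cone R X Y f \<in> D"
proof -
  have XY: "X \<in> complexes R" "Y \<in> complexes R" using assms by auto
  have F: "homotopy_class R X Y f \<in> KHom R X Y" by (rule homotopy_class_in_KHom[OF f])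
  obtain G H where "exact_triangle R X Y (cone R X Y f) (homotopy_class R X Y f) G H"
    using exact_triangle_cone[OF XY(1,2,2) f F kid_in_kisos[OF XY(2)]] kcomp_kid[OF XY F] by auto
  then show ?thesis using D X Y cone unfolding triangulated_subcat_def by blast
qed

locale triangulated_pair =
  fixes R :: "('r, 'm) ring_scheme" and T D :: "('r, 'v::universe) cpx set"
  assumes T: "triangulated_subcat R (complexes R) T" and D: "triangulated_subcat R T D"
begin

lemma T_complex: "X \<in> T \<Longrightarrow> X \<in> complexes R"
  using T unfolding triangulated_subcat_def by blast

lemma D_T: "X \<in> D \<Longrightarrow> X \<in> T"
  using D unfolding triangulated_subcat_def by blast

lemma D_complex: "X \<in> D \<Longrightarrow> X \<in> complexes R"
  by (simp add: D_T T_complex)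

lemma cone_in_T: "\<lbrakk>X \<in> T; Y \<in> T; f \<in> cochain_maps R X Y\<rbrakk> \<Longrightarrow> cone R X Y f \<in> T"
  by (rule triangulated_subcat_cone[OF T]) (auto simp: T_complex cone_in_complexes)

lemma cone_in_D: "\<lbrakk>X \<in> D; Y \<in> D; f \<in> cochain_maps R X Y\<rbrakk> \<Longrightarrow> cone R X Y f \<in> D"
  by (rule triangulated_subcat_cone[OF D]) (auto simp: D_complex D_T cone_in_T)

lemma fiber_in_T: "\<lbrakk>X \<in> T; Y \<in> T; f \<in> cochain_maps R X Y\<rbrakk> \<Longrightarrow> fiber R X Y f \<in> T"
  unfolding fiber_def by (rule triangulated_subcat_shift[OF T]) (auto simp: T_complex cone_in_T)

text \<open>The premise concerns the cone and not the ends of \<open>f\<close>: for a representative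
  of a morphism in \<open>Mor\<close>, the cone is what is known to lie in \<open>D\<close>.\<close>

lemma fiber_in_D: "cone R X Y f \<in> D \<Longrightarrow> fiber R X Y f \<in> D"
  unfolding fiber_def by (rule triangulated_subcat_shift[OF D]) (auto simp: D_complex)

lemma MorD:
  assumes "F \<in> Mor R T D X Y"
  shows "X \<in> T" "Y \<in> T" "F \<in> KHom R X Y"
  using assms by (auto simp: Mor_def)

text \<open>The comparison isomorphism on third terms moves membership in \<open>D\<close> from
  \<open>Z\<close> to the cone of \<open>f\<close>. Closure of \<open>D\<close> under isomorphisms
  covers targets in \<open>T\<close> only, so \<open>X'\<close>, \<open>Y'\<close> and then the cone
  are placed in \<open>T\<close> first.\<close>

lemma Mor_cases:
  assumes F: "F \<in> Mor R T D X Y"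
  obtains X' Y' f A B where "X' \<in> T" "Y' \<in> T" "f \<in> cochain_maps R X' Y'" "cone R X' Y' f \<in> D"
    "A \<in> kisos R X X'" "B \<in> kisos R Y Y'" "kcomp R X Y' B F = kcomp R X Y' (homotopy_class R X' Y' f) A"
proof -
  obtain Z G H where Z: "Z \<in> D" and tri: "exact_triangle R X Y Z F G H"
    using F by (auto simp: Mor_def)
  obtain X' Y' f A B C where X': "X' \<in> complexes R" "Y' \<in> complexes R" and f: "f \<in> cochain_maps R X' Y'"
    and A: "A \<in> kisos R X X'" and B: "B \<in> kisos R Y Y'" and C: "C \<in> kisos R Z (cone R X' Y' f)"
    and eq: "kcomp R X Y' B F = kcomp R X Y' (homotopy_class R X' Y' f) A"
    using tri unfolding exact_triangle_def by blast
  have T': "X' \<in> T" "Y' \<in> T" using triangulated_subcat_kisos[OF T] MorD[OF F] X' A B by blast+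
  have "cone R X' Y' f \<in> D" by (rule triangulated_subcat_kisos[OF D Z cone_in_T[OF T' f] C])
  then show ?thesis using that T' f A B eq by blast
qed

lemma MorI:
  assumes X: "X \<in> T" and Y: "Y \<in> T" and Y': "Y' \<in> T" and f: "f \<in> cochain_maps R X Y'"
    and cone: "cone R X Y' f \<in> D" and F: "F \<in> KHom R X Y" and B: "B \<in> kisos R Y Y'"
    and BF: "kcomp R X Y' B F = homotopy_class R X Y' f"
  shows "F \<in> Mor R T D X Y"
  using exact_triangle_cone[OF T_complex[OF X] T_complex[OF Y] T_complex[OF Y'] f F B BF] X Y F cone
  by (auto simp: Mor_def)

lemma cofiber_in_D:
  assumes Z: "Z \<in> T" and X: "X \<in> T" and K: "K \<in> D" and f: "f \<in> cochain_maps R Z X" and b: "b \<in> cochain_maps R Z K"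
    and cone: "cone R Z X f \<in> D"
  shows "cofiber R Z X K f b \<in> D"
proof -
  note cs = T_complex[OF Z] T_complex[OF X] D_complex[OF K]
  \<comment> \<open>With the roles of \<open>f\<close> and \<open>b\<close> exchanged, this is the
    cone of a map from the fiber of \<open>f\<close>, a shift of its cone, to \<open>K\<close>; both
    ends lie in \<open>D\<close>.\<close>
  have "cofiber R Z K X b f \<in> D" unfolding cofiber_def
    by (rule cone_in_D[OF fiber_in_D[OF cone] K comp_fiber_proj_in_cochain_maps[OF cs(1,3,2) b f]])
  moreover have "cofiber R Z X K f b \<in> T" unfolding cofiber_def
    by (rule cone_in_T[OF fiber_in_T[OF Z D_T[OF K] b] X comp_fiber_proj_in_cochain_maps[OF cs f b]])
  ultimately show ?thesis
    using cofiber_swap[OF cs(1,3,2) b f] triangulated_subcat_kisos[OF D] by blast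
qed

text \<open>A map from the source of a denominator to an object of \<open>D\<close> can be killed by
  refining the denominator. It is used twice: to pull back one denominator along another, and to
  make two numerators equal.\<close>

lemma Mor_precomp:
  assumes F: "F \<in> Mor R T D Z X" and K: "K \<in> D" and b: "b \<in> KHom R Z K"
  shows "\<exists>W\<in>T. \<exists>U\<in>KHom R W Z. kcomp R W X F U \<in> Mor R T D W X \<and> kcomp R W K b U = kzero R W K"
proof -
  obtain Z' X' f A B where Z': "Z' \<in> T" and X': "X' \<in> T" and f: "f \<in> cochain_maps R Z' X'"
    and cone: "cone R Z' X' f \<in> D" and A: "A \<in> kisos R Z Z'" and B: "B \<in> kisos R X X'"
    and eq: "kcomp R Z X' B F = kcomp R Z X' (homotopy_class R Z' X' f) A"
    using F by (rule Mor_cases)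
  obtain A' where A': "A' \<in> kisos R Z' Z" and AA': "kcomp R Z' Z' A A' = kid R Z'"
    using A by (rule kiso_inverse)
  note h = kisos_KHom[OF A] kisos_KHom[OF A'] kisos_KHom[OF B] MorD(3)[OF F]
  note c = MorD(1,2)[OF F, THEN T_complex] T_complex[OF Z'] T_complex[OF X'] D_complex[OF K]
  obtain b' where b': "b' \<in> cochain_maps R Z' K" "kcomp R Z' K b A' = homotopy_class R Z' K b'"
    using kcomp_closed[OF c(3,1,5) h(2) b] by (rule KHom_cases)
  let ?W = "fiber R Z' K b'" and ?w = "fiber_proj R Z' K"
  have W: "?W \<in> T" by (rule fiber_in_T[OF Z' D_T[OF K] b'(1)])
  note Wc = T_complex[OF W]
  have w: "?w \<in> cochain_maps R ?W Z'" by (rule fiber_proj_in_cochain_maps[OF c(3,5) b'(1)])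
  let ?w' = "homotopy_class R ?W Z' ?w" and ?f = "homotopy_class R Z' X' f"
  have w': "?w' \<in> KHom R ?W Z'" by (rule homotopy_class_in_KHom[OF w])
  have f': "?f \<in> KHom R Z' X'" by (rule homotopy_class_in_KHom[OF f])
  \<comment> \<open>As \<open>A'\<close> is inverse to \<open>A\<close>, the composite
    \<open>B F U\<close> becomes \<open>f w\<close>, whose cone is the cofiber of \<open>f\<close>
    and \<open>b'\<close>.\<close>
  let ?U = "kcomp R ?W Z A' ?w'"
  have U: "?U \<in> KHom R ?W Z" by (rule kcomp_closed[OF Wc c(3,1) w' h(2)])
  have FU: "kcomp R ?W X F ?U \<in> KHom R ?W X" by (rule kcomp_closed[OF Wc c(1,2) U h(4)])
  have "kcomp R ?W X' B (kcomp R ?W X F ?U) = kcomp R ?W X' (kcomp R Z X' ?f A) ?U"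
    using kcomp_assoc[OF Wc c(1,2,4) U h(4,3)] eq by simp
  also have "\<dots> = kcomp R ?W X' ?f (kcomp R ?W Z' A ?U)"
    using kcomp_assoc[OF Wc c(1,3,4) U h(1) f'] by simp
  also have "kcomp R ?W Z' A ?U = ?w'"
    using kcomp_assoc[OF Wc c(3,1,3) w' h(2,1)] AA' kcomp_kid[OF Wc c(3) w'] by simp
  also have "kcomp R ?W X' ?f ?w' = homotopy_class R ?W X' (comp_maps ?W f ?w)"
    by (rule kcomp_homotopy_class[OF Wc c(3,4) w f])
  finally have "kcomp R ?W X F ?U \<in> Mor R T D ?W X"
    using cofiber_in_D[OF Z' X' K f b'(1) cone] unfolding cofiber_def
    by (intro MorI[OF W MorD(2)[OF F] X' comp_fiber_proj_in_cochain_maps[OF c(3,4,5) f b'(1)] _ FU B])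
  moreover have "kcomp R ?W K b ?U = kzero R ?W K"
  proof -
    have "kcomp R ?W K b ?U = kcomp R ?W K (homotopy_class R Z' K b') ?w'"
      using kcomp_assoc[OF Wc c(3,1,5) w' h(2) b] b'(2) by simp
    also have "\<dots> = homotopy_class R ?W K (comp_maps ?W b' ?w)"
      by (rule kcomp_homotopy_class[OF Wc c(3,5) w b'(1)])
    also have "\<dots> = kzero R ?W K" unfolding kzero_def
      using homotopy_class_eq_iff[OF Wc c(5) cochain_maps_comp[OF Wc c(3,5) w b'(1)] zero_map_in_cochain_maps[OF Wc c(5)]]
        fiber_proj_null[OF c(3,5) b'(1)] by simp
    finally show ?thesis .
  qed
  ultimately show ?thesis using W U by blast
qed

text \<open>\<open>C\<close> is the map to the cone of a representative of \<open>F\<close>,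
  composed with \<open>B\<close>; \<open>cone_inj_weak_kernel\<close> gives the lift. Applying
  \<open>Mor_precomp\<close> to the composite of \<open>C\<close> with another denominator then
  yields an Ore square.\<close>

lemma Mor_weak_kernel:
  assumes F: "F \<in> Mor R T D Z X"
  shows "\<exists>K\<in>D. \<exists>C\<in>KHom R X K. \<forall>W\<in>T. \<forall>S\<in>KHom R W X.
    kcomp R W K C S = kzero R W K \<longrightarrow> (\<exists>V\<in>KHom R W Z. kcomp R W X F V = S)"
proof -
  obtain Z' X' f A B where Z': "Z' \<in> T" and X': "X' \<in> T" and f: "f \<in> cochain_maps R Z' X'"
    and cone: "cone R Z' X' f \<in> D" and A: "A \<in> kisos R Z Z'" and B: "B \<in> kisos R X X'"
    and eq: "kcomp R Z X' B F = kcomp R Z X' (homotopy_class R Z' X' f) A"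
    using F by (rule Mor_cases)
  obtain A' where A': "A' \<in> kisos R Z' Z" and AA': "kcomp R Z' Z' A A' = kid R Z'"
    using A by (rule kiso_inverse)
  let ?K = "cone R Z' X' f" and ?j = "homotopy_class R X' (cone R Z' X' f) (cone_inj Z' X')"
    and ?f = "homotopy_class R Z' X' f"
  note h = kisos_KHom[OF A] kisos_KHom[OF A'] kisos_KHom[OF B] MorD(3)[OF F]
  note c = MorD(1,2)[OF F, THEN T_complex] T_complex[OF Z'] T_complex[OF X'] D_complex[OF cone]
  have j: "cone_inj Z' X' \<in> cochain_maps R X' ?K" by (rule cone_inj_in_cochain_maps[OF c(3,4) f])
  have j': "?j \<in> KHom R X' ?K" by (rule homotopy_class_in_KHom[OF j])
  have f': "?f \<in> KHom R Z' X'" by (rule homotopy_class_in_KHom[OF f])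
  have "\<exists>V\<in>KHom R W Z. kcomp R W X F V = S"
    if "W \<in> T" and S: "S \<in> KHom R W X" and null: "kcomp R W ?K (kcomp R X ?K ?j B) S = kzero R W ?K" for W S
  proof -
    have W: "W \<in> complexes R" by (rule T_complex[OF \<open>W \<in> T\<close>])
    obtain t where t: "t \<in> cochain_maps R W X'" "kcomp R W X' B S = homotopy_class R W X' t"
      using kcomp_closed[OF W c(2,4) S h(3)] by (rule KHom_cases)
    have "homotopy_class R W ?K (comp_maps W (cone_inj Z' X') t) = kcomp R W ?K ?j (kcomp R W X' B S)"
      using kcomp_homotopy_class[OF W c(4,5) t(1) j] t(2) by simp
    also have "\<dots> = homotopy_class R W ?K (zero_map W ?K)"
      using kcomp_assoc[OF W c(2,4,5) S h(3) j'] null by (simp add: kzero_def)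
    finally have "homotopic R W ?K (comp_maps W (cone_inj Z' X') t) (zero_map W ?K)"
      using homotopy_class_eq_iff[OF W c(5) cochain_maps_comp[OF W c(4,5) t(1) j] zero_map_in_cochain_maps[OF W c(5)]] by simp
    then obtain v where v: "v \<in> cochain_maps R W Z'" "homotopic R W X' t (comp_maps W f v)"
      using cone_inj_weak_kernel[OF W c(3,4) f t(1)] by blast
    let ?v = "homotopy_class R W Z' v"
    have v': "?v \<in> KHom R W Z'" by (rule homotopy_class_in_KHom[OF v(1)])
    let ?V = "kcomp R W Z A' ?v"
    have V: "?V \<in> KHom R W Z" by (rule kcomp_closed[OF W c(3,1) v' h(2)])
    have "kcomp R W X' B (kcomp R W X F ?V) = kcomp R W X' (kcomp R Z X' ?f A) ?V"
      using kcomp_assoc[OF W c(1,2,4) V h(4,3)] eq by simp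
    also have "\<dots> = kcomp R W X' ?f (kcomp R W Z' A ?V)"
      using kcomp_assoc[OF W c(1,3,4) V h(1) f'] by simp
    also have "kcomp R W Z' A ?V = ?v"
      using kcomp_assoc[OF W c(3,1,3) v' h(2,1)] AA' kcomp_kid[OF W c(3) v'] by simp
    also have "kcomp R W X' ?f ?v = homotopy_class R W X' (comp_maps W f v)"
      by (rule kcomp_homotopy_class[OF W c(3,4) v(1) f])
    also have "\<dots> = kcomp R W X' B S"
      using homotopy_class_eq_iff[OF W c(4) t(1) cochain_maps_comp[OF W c(3,4) v(1) f]] v(2) t(2) by simp
    finally have "kcomp R W X F ?V = S"
      by (rule kiso_cancel[OF W c(2,4) B kcomp_closed[OF W c(1,2) V h(4)] S])
    then show ?thesis using V by blast
  qed
  moreover have "kcomp R X ?K ?j B \<in> KHom R X ?K" by (rule kcomp_closed[OF c(2,4,5) h(3) j'])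
  ultimately show ?thesis using cone by blast
qed

text \<open>After transport along \<open>A\<close>, the difference of \<open>F\<close> and
  \<open>G\<close> lifts to the fiber of a representative of \<open>I\<close>, which lies in
  \<open>D\<close>. \<open>Q\<close> is this lift, so whatever kills \<open>Q\<close> kills the
  difference.\<close>

lemma Mor_coequalizing:
  assumes I: "I \<in> Mor R T D Y E" and WT: "W \<in> T" and F: "F \<in> KHom R W Y" and G: "G \<in> KHom R W Y"
    and IF: "kcomp R W E I F = kcomp R W E I G"
  shows "\<exists>K\<in>D. \<exists>Q\<in>KHom R W K. \<forall>V\<in>T. \<forall>U\<in>KHom R V W.
    kcomp R V K Q U = kzero R V K \<longrightarrow> kcomp R V Y F U = kcomp R V Y G U"
proof -
  obtain Y' E' i A B where Y': "Y' \<in> T" and E': "E' \<in> T" and i: "i \<in> cochain_maps R Y' E'"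
    and cone: "cone R Y' E' i \<in> D" and A: "A \<in> kisos R Y Y'" and B: "B \<in> kisos R E E'"
    and eq: "kcomp R Y E' B I = kcomp R Y E' (homotopy_class R Y' E' i) A"
    using I by (rule Mor_cases)
  let ?K = "fiber R Y' E' i" and ?i = "homotopy_class R Y' E' i"
  note h = kisos_KHom[OF A] kisos_KHom[OF B] MorD(3)[OF I]
  have K: "?K \<in> D" by (rule fiber_in_D[OF cone])
  note c = MorD(1,2)[OF I, THEN T_complex] T_complex[OF Y'] T_complex[OF E'] D_complex[OF K] T_complex[OF WT]
  have i': "?i \<in> KHom R Y' E'" by (rule homotopy_class_in_KHom[OF i])
  obtain f where f: "f \<in> cochain_maps R W Y'" "kcomp R W Y' A F = homotopy_class R W Y' f"
    using kcomp_closed[OF c(6,1,3) F h(1)] by (rule KHom_cases)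
  obtain g where g: "g \<in> cochain_maps R W Y'" "kcomp R W Y' A G = homotopy_class R W Y' g"
    using kcomp_closed[OF c(6,1,3) G h(1)] by (rule KHom_cases)
  have IA: "kcomp R W E' ?i (kcomp R W Y' A S) = kcomp R W E' B (kcomp R W E I S)" if "S \<in> KHom R W Y" for S
    using kcomp_assoc[OF c(6,1,3,4) that h(1) i'] kcomp_assoc[OF c(6,1,2,4) that h(3,2)] eq by simp
  have "homotopy_class R W E' (comp_maps W i f) = homotopy_class R W E' (comp_maps W i g)"
    using kcomp_homotopy_class[OF c(6,3,4) f(1) i] kcomp_homotopy_class[OF c(6,3,4) g(1) i] IA[OF F] IA[OF G] IF f(2) g(2)
    by simp
  then have "homotopic R W E' (comp_maps W i f) (comp_maps W i g)"
    using homotopy_class_eq_iff[OF c(6,4) cochain_maps_comp[OF c(6,3,4) f(1) i] cochain_maps_comp[OF c(6,3,4) g(1) i]] by simp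
  then obtain q where q: "q \<in> cochain_maps R W ?K"
    and q_eq: "\<forall>n. \<forall>x\<in>carrier (obj W n). vfst (q n x) = f n x \<ominus>\<^bsub>obj Y' n\<^esub> g n x"
    using fiber_lift[OF c(6,3,4) i f(1) g(1)] by blast
  let ?q = "homotopy_class R W ?K q"
  let ?p = "fiber_proj R Y' E'"
  have p: "?p \<in> cochain_maps R ?K Y'" by (rule fiber_proj_in_cochain_maps[OF c(3,4) i])
  have "kcomp R V Y F U = kcomp R V Y G U"
    if "V \<in> T" and U: "U \<in> KHom R V W" and null: "kcomp R V ?K ?q U = kzero R V ?K" for V U
  proof -
    have V: "V \<in> complexes R" by (rule T_complex[OF \<open>V \<in> T\<close>])
    obtain u where u: "u \<in> cochain_maps R V W" "U = homotopy_class R V W u" using U by (rule KHom_cases)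
    let ?qu = "comp_maps V q u"
    have qu: "?qu \<in> cochain_maps R V ?K" by (rule cochain_maps_comp[OF V c(6,5) u(1) q])
    have "homotopy_class R V Y' (comp_maps V ?p ?qu) = kcomp R V Y' (homotopy_class R ?K Y' ?p) (kzero R V ?K)"
      using kcomp_homotopy_class[OF V c(5,3) qu p] kcomp_homotopy_class[OF V c(6,5) u(1) q] null u(2) by simp
    also have "\<dots> = homotopy_class R V Y' (zero_map V Y')"
      using kcomp_kzero[OF V c(5,3) homotopy_class_in_KHom[OF p]] by (simp add: kzero_def)
    finally have "homotopic R V Y' (comp_maps V ?p ?qu) (zero_map V Y')"
      using homotopy_class_eq_iff[OF V c(3) cochain_maps_comp[OF V c(5,3) qu p] zero_map_in_cochain_maps[OF V c(3)]] by simp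
    \<comment> \<open>The first coordinate of \<open>q u\<close> is \<open>f u - g u\<close>, so a
      null homotopy of the projection joins \<open>f u\<close> to \<open>g u\<close>.\<close>
    then have "homotopic R V Y' (comp_maps V f u) (comp_maps V g u)"
    proof (rule homotopic_if_difference_null[OF V c(3) cochain_maps_comp[OF V c(6,3) u(1) f(1)] cochain_maps_comp[OF V c(6,3) u(1) g(1)]])
      fix n x assume x: "x \<in> carrier (obj V n)"
      show "comp_maps V ?p ?qu n x = comp_maps V f u n x \<ominus>\<^bsub>obj Y' n\<^esub> comp_maps V g u n x"
        using x q_eq cochain_map_closed[OF u(1) x] cochain_map_closed[OF q cochain_map_closed[OF u(1) x]]
        by (simp add: fiber_proj_def)
    qed
    then have "homotopy_class R V Y' (comp_maps V f u) = homotopy_class R V Y' (comp_maps V g u)"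
      using homotopy_class_eq_iff[OF V c(3) cochain_maps_comp[OF V c(6,3) u(1) f(1)] cochain_maps_comp[OF V c(6,3) u(1) g(1)]] by simp
    then have "kcomp R V Y' (kcomp R W Y' A F) U = kcomp R V Y' (kcomp R W Y' A G) U"
      using f(2) g(2) u(2) kcomp_homotopy_class[OF V c(6,3) u(1) f(1)] kcomp_homotopy_class[OF V c(6,3) u(1) g(1)] by simp
    then have "kcomp R V Y' A (kcomp R V Y F U) = kcomp R V Y' A (kcomp R V Y G U)"
      using kcomp_assoc[OF V c(6,1,3) U F h(1)] kcomp_assoc[OF V c(6,1,3) U G h(1)] by simp
    then show ?thesis
      by (rule kiso_cancel[OF V c(1,3) A kcomp_closed[OF V c(6,1) U F] kcomp_closed[OF V c(6,1) U G]])
  qed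
  then show ?thesis using K homotopy_class_in_KHom[OF q] by blast
qed

section \<open>Equivalence of roofs\<close>

lemma roof_equiv_iff:
  "((Z, F, G), (Z', F', G')) \<in> roof_equiv R T D X Y \<longleftrightarrow>
     (Z, F, G) \<in> roofs R T D X Y \<and> (Z', F', G') \<in> roofs R T D X Y \<and>
     (\<exists>Z'' F'' G''. (Z'', F'', G'') \<in> roofs R T D X Y \<and>
        (\<exists>U\<in>KHom R Z'' Z. \<exists>V\<in>KHom R Z'' Z'.
           kcomp R Z'' X F U = F'' \<and> F'' = kcomp R Z'' X F' V \<and>
           kcomp R Z'' Y G U = G'' \<and> G'' = kcomp R Z'' Y G' V))"
  by (simp add: roof_equiv_def)

lemma roof_equivI:
  assumes I: "I \<in> Mor R T D Y E" and H: "H \<in> KHom R X E"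
    and r: "(Z, F, G) \<in> roofs R T D X Y" and r': "(Z', F', G') \<in> roofs R T D X Y"
    and eq: "kcomp R Z E H F = kcomp R Z E I G" and eq': "kcomp R Z' E H F' = kcomp R Z' E I G'"
  shows "((Z, F, G), (Z', F', G')) \<in> roof_equiv R T D X Y"
proof -
  have F: "F \<in> Mor R T D Z X" and G: "G \<in> KHom R Z Y" and F': "F' \<in> Mor R T D Z' X" and G': "G' \<in> KHom R Z' Y"
    using r r' by (auto simp: roofs_def)
  note c = MorD(1,2)[OF F, THEN T_complex] MorD(1)[OF F', THEN T_complex] MorD(1,2)[OF I, THEN T_complex]
  note Fh = MorD(3)[OF F] and F'h = MorD(3)[OF F'] and Ih = MorD(3)[OF I]
  obtain K C where K: "K \<in> D" and C: "C \<in> KHom R X K" and CK: "\<forall>W\<in>T. \<forall>S\<in>KHom R W X.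
    kcomp R W K C S = kzero R W K \<longrightarrow> (\<exists>V\<in>KHom R W Z'. kcomp R W X F' V = S)"
    using Mor_weak_kernel[OF F'] by (elim bexE)
  note Kc = D_complex[OF K]
  \<comment> \<open>\<open>C F\<close> maps \<open>Z\<close> to an object of \<open>D\<close>; once
    \<open>U\<close> kills it, \<open>F U\<close> lifts through \<open>F'\<close> as
    \<open>F' V\<close>.\<close>
  obtain W U where WT: "W \<in> T" and U: "U \<in> KHom R W Z" and FU: "kcomp R W X F U \<in> Mor R T D W X"
    and null: "kcomp R W K (kcomp R Z K C F) U = kzero R W K"
    using Mor_precomp[OF F K kcomp_closed[OF c(1,2) Kc Fh C]] by (elim bexE conjE)
  note W = T_complex[OF WT]
  have CFU: "kcomp R W K C (kcomp R W X F U) = kzero R W K"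
    using kcomp_assoc[OF W c(1,2) Kc U Fh C] null by simp
  obtain V where V: "V \<in> KHom R W Z'" "kcomp R W X F' V = kcomp R W X F U"
    using CK[rule_format, OF WT MorD(3)[OF FU] CFU] by (elim bexE)
  \<comment> \<open>The common \<open>H\<close> enters here: both numerators composed with
    \<open>I\<close> equal \<open>H\<close> after the denominator \<open>F U = F' V\<close>.\<close>
  have IG: "kcomp R W E I (kcomp R W Y G U) = kcomp R W E H (kcomp R W X F U)"
    using kcomp_assoc[OF W c(1,4,5) U G Ih] kcomp_assoc[OF W c(1,2,5) U Fh H] eq by simp
  have IG': "kcomp R W E I (kcomp R W Y G' V) = kcomp R W E H (kcomp R W X F' V)"
    using kcomp_assoc[OF W c(3,4,5) V(1) G' Ih] kcomp_assoc[OF W c(3,2,5) V(1) F'h H] eq' by simp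
  have GU: "kcomp R W Y G U \<in> KHom R W Y" by (rule kcomp_closed[OF W c(1,4) U G])
  have GV: "kcomp R W Y G' V \<in> KHom R W Y" by (rule kcomp_closed[OF W c(3,4) V(1) G'])
  have IGG: "kcomp R W E I (kcomp R W Y G U) = kcomp R W E I (kcomp R W Y G' V)"
    using IG IG' V(2) by simp
  obtain L Q where L: "L \<in> D" and Q: "Q \<in> KHom R W L" and QL: "\<forall>N\<in>T. \<forall>S\<in>KHom R N W.
    kcomp R N L Q S = kzero R N L \<longrightarrow> kcomp R N Y (kcomp R W Y G U) S = kcomp R N Y (kcomp R W Y G' V) S"
    using Mor_coequalizing[OF I WT GU GV IGG] by (elim bexE)
  \<comment> \<open>The denominator must stay in \<open>Mor\<close> after this second refinement, so
    \<open>Mor_precomp\<close> is applied to \<open>F U\<close>.\<close>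
  obtain N S where NT: "N \<in> T" and S: "S \<in> KHom R N W" and FUS: "kcomp R N X (kcomp R W X F U) S \<in> Mor R T D N X"
    and null': "kcomp R N L Q S = kzero R N L"
    using Mor_precomp[OF FU L Q] by (elim bexE conjE)
  note N = T_complex[OF NT]
  let ?F = "kcomp R N X (kcomp R W X F U) S" and ?G = "kcomp R N Y (kcomp R W Y G U) S"
  let ?U = "kcomp R N Z U S" and ?V = "kcomp R N Z' V S"
  have NFG: "(N, ?F, ?G) \<in> roofs R T D X Y"
    using NT FUS kcomp_closed[OF N W c(4) S GU] by (simp add: roofs_def)
  have U': "?U \<in> KHom R N Z" and V': "?V \<in> KHom R N Z'"
    using kcomp_closed[OF N W c(1) S U] kcomp_closed[OF N W c(3) S V(1)] by simp_all
  have e: "kcomp R N X F ?U = ?F" "kcomp R N Y G ?U = ?G"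
    using kcomp_assoc[OF N W c(1,2) S U Fh] kcomp_assoc[OF N W c(1,4) S U G] by simp_all
  have e': "?F = kcomp R N X F' ?V" "?G = kcomp R N Y G' ?V"
    using kcomp_assoc[OF N W c(3,2) S V(1) F'h] kcomp_assoc[OF N W c(3,4) S V(1) G'] V(2) QL[rule_format, OF NT S null'] by simp_all
  show ?thesis
    unfolding roof_equiv_iff by (intro conjI exI[of _ N] exI[of _ ?F] exI[of _ ?G] bexI[OF _ U'] bexI[OF _ V'] r r' NFG e e')
qed

text \<open>A case of transitivity that follows by composition alone: the common refinement
  \<open>M\<close> of \<open>r\<close> and \<open>(N, P, Q)\<close> maps to \<open>N\<close> by
  \<open>W\<close>, hence to \<open>Z\<close> by \<open>V W\<close>.\<close>

lemma roof_equiv_extend: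
  assumes r: "(r, (N, P, Q)) \<in> roof_equiv R T D X Y" and XY: "X \<in> T" "Y \<in> T"
    and Z: "(Z, F, G) \<in> roofs R T D X Y" and V: "V \<in> KHom R N Z"
    and PQ: "P = kcomp R N X F V" "Q = kcomp R N Y G V"
  shows "(r, (Z, F, G)) \<in> roof_equiv R T D X Y"
proof -
  obtain Z1 F1 G1 where r1: "r = (Z1, F1, G1)" by (metis prod_cases3)
  obtain M A B U W where M: "(M, A, B) \<in> roofs R T D X Y" and U: "U \<in> KHom R M Z1" and W: "W \<in> KHom R M N"
    and e: "kcomp R M X F1 U = A" "A = kcomp R M X P W" "kcomp R M Y G1 U = B" "B = kcomp R M Y Q W"
    using r unfolding r1 roof_equiv_iff by (elim conjE exE bexE)
  have N: "(N, P, Q) \<in> roofs R T D X Y" using r unfolding r1 roof_equiv_iff by (elim conjE)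
  have r1': "(Z1, F1, G1) \<in> roofs R T D X Y" using r unfolding r1 roof_equiv_iff by (elim conjE)
  have c: "M \<in> complexes R" "N \<in> complexes R" "Z \<in> complexes R" "X \<in> complexes R" "Y \<in> complexes R"
    using M N Z XY by (simp_all add: roofs_def T_complex)
  have F: "F \<in> KHom R Z X" and G: "G \<in> KHom R Z Y" using Z MorD(3) by (auto simp: roofs_def)
  have V': "kcomp R M Z V W \<in> KHom R M Z" by (rule kcomp_closed[OF c(1,2,3) W V])
  have e': "A = kcomp R M X F (kcomp R M Z V W)" "B = kcomp R M Y G (kcomp R M Z V W)"
    using kcomp_assoc[OF c(1,2,3,4) W V F] kcomp_assoc[OF c(1,2,3,5) W V G] e(2,4) PQ by simp_all
  show ?thesis unfolding r1 roof_equiv_iff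
    by (intro conjI exI[of _ M] exI[of _ A] exI[of _ B] bexI[OF _ U] bexI[OF _ V'] r1' Z M e(1,3) e')
qed

text \<open>The condition \<open>H F = I G\<close> passes from \<open>(Z, F, G)\<close> to every
  refinement by precomposition. So it holds on a common refinement \<open>M\<close>, which also maps
  to \<open>N\<close>.\<close>

lemma roof_equiv_refines:
  assumes s: "((Z, F, G), (N, P, Q)) \<in> roof_equiv R T D X Y" and H: "H \<in> KHom R X E" and I: "I \<in> KHom R Y E"
    and XYE: "X \<in> T" "Y \<in> T" "E \<in> T" and eq: "kcomp R Z E H F = kcomp R Z E I G"
  obtains M A B V where "(M, A, B) \<in> roofs R T D X Y" "V \<in> KHom R M N"
    "A = kcomp R M X P V" "B = kcomp R M Y Q V" "kcomp R M E H A = kcomp R M E I B"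
proof -
  obtain M A B U V where M: "(M, A, B) \<in> roofs R T D X Y" and U: "U \<in> KHom R M Z" and V: "V \<in> KHom R M N"
    and e: "kcomp R M X F U = A" "A = kcomp R M X P V" "kcomp R M Y G U = B" "B = kcomp R M Y Q V"
    using s unfolding roof_equiv_iff by (elim conjE exE bexE)
  have Z: "(Z, F, G) \<in> roofs R T D X Y" using s unfolding roof_equiv_iff by (elim conjE)
  have c: "M \<in> complexes R" "Z \<in> complexes R" using M Z by (simp_all add: roofs_def T_complex)
  note c' = XYE[THEN T_complex]
  have F: "F \<in> KHom R Z X" and G: "G \<in> KHom R Z Y" using Z MorD(3) by (auto simp: roofs_def)
  have "kcomp R M E H A = kcomp R M E I B"
    using kcomp_assoc[OF c c'(1,3) U F H] kcomp_assoc[OF c c'(2,3) U G I] e(1,3) eq by simp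
  then show ?thesis by (rule that[OF M V e(2,4)])
qed

text \<open>A member \<open>(N, P, Q)\<close> of the first class shares with
  \<open>(Z, F, G)\<close> a refinement that admits \<open>H\<close>. By \<open>roof_equivI\<close>
  this refinement is equivalent to \<open>(Z', F', G')\<close>, and \<open>roof_equiv_extend\<close>
  passes from it to \<open>(N, P, Q)\<close>. The hypotheses are symmetric in the two roofs, so
  equality of classes follows.\<close>

lemma roof_equiv_class_subset:
  assumes I: "I \<in> Mor R T D Y E" and H: "H \<in> KHom R X E" and X: "X \<in> T"
    and r: "(Z, F, G) \<in> roofs R T D X Y" and r': "(Z', F', G') \<in> roofs R T D X Y"
    and eq: "kcomp R Z E H F = kcomp R Z E I G" and eq': "kcomp R Z' E H F' = kcomp R Z' E I G'"
  shows "roof_equiv R T D X Y `` {(Z, F, G)} \<subseteq> roof_equiv R T D X Y `` {(Z', F', G')}"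
proof (rule subsetI)
  fix t assume t: "t \<in> roof_equiv R T D X Y `` {(Z, F, G)}"
  obtain N P Q where t_eq: "t = (N, P, Q)" by (rule prod_cases3)
  have s: "((Z, F, G), (N, P, Q)) \<in> roof_equiv R T D X Y" using t t_eq by simp
  then have N: "(N, P, Q) \<in> roofs R T D X Y" unfolding roof_equiv_iff by (elim conjE)
  note XYE = X MorD(1,2)[OF I]
  obtain M A B V where M: "(M, A, B) \<in> roofs R T D X Y" "V \<in> KHom R M N"
    "A = kcomp R M X P V" "B = kcomp R M Y Q V" "kcomp R M E H A = kcomp R M E I B"
    by (rule roof_equiv_refines[OF s H MorD(3)[OF I] XYE eq])
  have "((Z', F', G'), (M, A, B)) \<in> roof_equiv R T D X Y"
    by (rule roof_equivI[OF I H r' M(1) eq' M(5)])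
  then show "t \<in> roof_equiv R T D X Y `` {(Z', F', G')}"
    using t_eq roof_equiv_extend[OF _ XYE(1,2) N M(2,3,4)] by simp
qed

end


section \<open>Smallness of the Hom-sets\<close>

text \<open>A map is coded by the set of its values, each tagged by its degree \<open>k n\<close>
  and argument. Extensionality makes this code injective, all codes are subsets of the small set
  \<open>S\<close>, and the strong limit property bounds \<open>Pow S\<close>.\<close>

lemma small_cochain_maps:
  fixes X Y :: "('r, 'v::universe) cpx"
  assumes X: "X \<in> complexes R" and Y: "Y \<in> complexes R"
  shows "cochain_maps R X Y \<prec> (UNIV :: 'v set)"
proof -
  obtain k :: "int \<Rightarrow> 'v" where "inj k" using ex_inj_int by blast
  then have k: "k n = k m \<longleftrightarrow> n = m" for n m by (simp add: inj_eq)
  define S where "S = (\<Union>n. (\<lambda>q. vpair (k n, q)) ` vpair ` (carrier (obj X n) \<times> carrier (obj Y n)))"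
  define graph where "graph f = (\<Union>n. (\<lambda>x. vpair (k n, vpair (x, f n x))) ` carrier (obj X n))" for f :: "int \<Rightarrow> 'v \<Rightarrow> 'v"
  have "carrier (obj X n) \<prec> (UNIV :: 'v set)" "carrier (obj Y n) \<prec> (UNIV :: 'v set)" for n
    using right_modules_obj[OF X, of n] right_modules_obj[OF Y, of n] by (simp_all add: right_modules_def)
  then have "S \<prec> (UNIV :: 'v set)"
    unfolding S_def by (intro small_UN_int small_image small_vpair_Times)
  then have "Pow S \<prec> (UNIV :: 'v set)" by (rule small_Pow)
  moreover have "inj_on graph (cochain_maps R X Y)"
  proof (intro inj_onI ext)
    fix f g n x
    assume f: "f \<in> cochain_maps R X Y" and g: "g \<in> cochain_maps R X Y" and eq: "graph f = graph g"
    show "f n x = g n x"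
    proof (cases "x \<in> carrier (obj X n)")
      case True
      then have "vpair (k n, vpair (x, f n x)) \<in> graph g" unfolding eq[symmetric] by (auto simp: graph_def)
      then show ?thesis by (auto simp: graph_def k)
    next
      case False
      then show ?thesis using cochain_map_extensional[OF f, of n] cochain_map_extensional[OF g, of n]
        by (simp add: extensional_def)
    qed
  qed
  moreover have "graph ` cochain_maps R X Y \<subseteq> Pow S"
    by (auto simp: graph_def S_def cochain_map_closed)
  ultimately show ?thesis using lesspoll_trans1 lepoll_def by metis
qed

lemma small_KHom:
  fixes X Y :: "('r, 'v::universe) cpx"
  assumes "X \<in> complexes R" and "Y \<in> complexes R"
  shows "KHom R X Y \<prec> (UNIV :: 'v set)"
proof -
  have "KHom R X Y = homotopy_class R X Y ` cochain_maps R X Y"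
    by (auto simp: KHom_def quotient_def homotopy_class_def)
  then show ?thesis using small_cochain_maps[OF assms] image_lepoll lesspoll_trans1 by metis
qed

theorem lemma4p1:
  fixes R :: "('r, 'm) ring_scheme"
    and T D :: "('r, 'v::universe) cpx set"
  assumes "ring R" and "carrier R \<prec> (UNIV :: 'v set)"
    and "triangulated_subcat R (complexes R) T"
    and "thick_subcat R T D"
    and "enough_Mor_injectives R T D"
  shows "small_verdier_homs R T D"
  unfolding small_verdier_homs_def
proof (intro ballI)
  fix X Y assume X: "X \<in> T" and Y: "Y \<in> T"
  interpret triangulated_pair R T D
    using assms by unfold_locales (simp_all add: thick_subcat_def)
  obtain E I where E: "Mor_injective R T D E" and I: "I \<in> Mor R T D Y E"
    using assms(5) Y unfolding enough_Mor_injectives_def by blast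
  \<comment> \<open>\<open>H\<close> only has to fit one representative of \<open>C\<close>; that is
    all \<open>roof_equiv_class_subset\<close> asks of each class.\<close>
  let ?P = "\<lambda>C H. \<exists>Z F G. (Z, F, G) \<in> roofs R T D X Y \<and> C = roof_equiv R T D X Y `` {(Z, F, G)} \<and>
    H \<in> KHom R X E \<and> kcomp R Z E H F = kcomp R Z E I G"
  have ex: "\<exists>H. ?P C H" if C: "C \<in> verdier_hom R T D X Y" for C
  proof -
    obtain Z F G where r: "(Z, F, G) \<in> roofs R T D X Y" and C_eq: "C = roof_equiv R T D X Y `` {(Z, F, G)}"
      using C unfolding verdier_hom_def by (auto elim!: quotientE)
    have Z: "Z \<in> T" and F: "F \<in> Mor R T D Z X" and G: "G \<in> KHom R Z Y" using r by (auto simp: roofs_def)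
    have "kcomp R Z E I G \<in> KHom R Z E"
      by (rule kcomp_closed[OF T_complex[OF Z] T_complex[OF Y] T_complex[OF MorD(2)[OF I]] G MorD(3)[OF I]])
    also have "KHom R Z E = (\<lambda>H. kcomp R Z E H F) ` KHom R X E"
      using E Z X F unfolding Mor_injective_def by auto
    finally obtain H where "H \<in> KHom R X E" "kcomp R Z E H F = kcomp R Z E I G" by auto
    then show ?thesis using r C_eq by blast
  qed
  define \<phi> where "\<phi> C = (SOME H. ?P C H)" for C
  have \<phi>: "?P C (\<phi> C)" if "C \<in> verdier_hom R T D X Y" for C
    unfolding \<phi>_def by (rule someI_ex[OF ex[OF that]])
  have "inj_on \<phi> (verdier_hom R T D X Y)"
  proof (rule inj_onI)
    fix C C' assume C: "C \<in> verdier_hom R T D X Y" and C': "C' \<in> verdier_hom R T D X Y" and eq: "\<phi> C = \<phi> C'"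
    \<comment> \<open>Folding \<open>eq\<close> makes the same \<open>H\<close> fit representatives
      of both classes, and the subset lemma is used in both directions.\<close>
    show "C = C'" using \<phi>[OF C] \<phi>[OF C', folded eq] roof_equiv_class_subset[OF I _ X] by (elim exE conjE) (simp add: subset_antisym)
  qed
  moreover have "\<phi> ` verdier_hom R T D X Y \<subseteq> KHom R X E" using \<phi> by blast
  ultimately have "verdier_hom R T D X Y \<lesssim> KHom R X E" unfolding lepoll_def by blast
  then show "verdier_hom R T D X Y \<prec> (UNIV :: 'v set)"
    using small_KHom[OF T_complex[OF X] T_complex[OF MorD(2)[OF I]]] by (rule lesspoll_trans1)
qed

end
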